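(* Let $D$ be a weighted oriented graph with underlying simple graph $G$ such that the edge ideal $I(D)$ has linear quotients. Then $$\sqrt{HS_k(I(D))}=HS_k(I(G))\quad\text{for all } k\ge 0.$$
   Context: $R=\mathbb{K}[x_1,\dots,x_n]$ over a field $\mathbb{K}$. A weighted oriented graph $D$ on $V(D)=\{x_1,\dots,x_n\}$ is a finite simple graph $G$ (the underlying graph) in which each edge is given exactly one orientation, with a weight function $w:V(D)\to\{1,2,\dots\}$, $w_i=w(x_i)$; sources (vertices with no incoming edge) are assumed to have weight $1$. The edge ideal is $I(D)=(x_ix_j^{w_j} : (x_i,x_j)\in E(D))\subseteq R$, where $(x_i,x_j)$ denotes an edge oriented $x_i\to x_j$, and $I(G)=(x_ix_j:\{x_i,x_j\}\in E(G))$. A monomial ideal $J$ with minimal monomial generating set $\mathcal{G}(J)$ has linear quotients if there is an order $u_1<\dots<u_m$ of $\mathcal{G}(J)$ such that $(u_1,\dots,u_{i-1}):u_i$ is generated by a subset of the variables for $i=2,\dots,m$. The $k$th homological shift ideal is $HS_k(J)=(\mathbf{x}^{\mathbf{a}} : \beta_{k,\mathbf{a}}(J)\ne 0)$, where $\beta_{k,\mathbf{a}}(J)$ are the multigraded Betti numbers of the minimal $\mathbb{N}^n$-graded free resolution of $J$ (so $HS_0(J)=J$). *)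

theory Defs
  imports Complex_Main "HOL-Library.Poly_Mapping"
begin

section \<open>Polynomials and ideals\<close>

text \<open>
  The polynomial ring over a field \<open>'k\<close> in the variables indexed by the finite type \<open>'n\<close>:
  finitely supported maps from exponent vectors to coefficients, multiplied by convolution.
\<close>

type_synonym 'n expo = "'n \<Rightarrow>\<^sub>0 nat"
type_synonym ('n, 'k) mpoly = "'n expo \<Rightarrow>\<^sub>0 'k"

definition monomial :: "'n expo \<Rightarrow> ('n, 'k::field) mpoly" where
  "monomial a = Poly_Mapping.single a 1"

definition var :: "'n \<Rightarrow> ('n, 'k::field) mpoly" where
  "var i = monomial (Poly_Mapping.single i 1)"

text \<open>
  A commutative ring as a module over itself: the submodules are the ideals, and \<open>ideal.span S\<close>
  is the ideal generated by \<open>S\<close>.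
\<close>

interpretation ideal: module "(*) :: 'a::comm_ring_1 \<Rightarrow> 'a \<Rightarrow> 'a"
  by standard (simp_all add: algebra_simps)

definition radical :: "'a::comm_ring_1 set \<Rightarrow> 'a set" where
  "radical I = {f. \<exists>m\<ge>1. f ^ m \<in> I}"

definition colon :: "'a::comm_ring_1 set \<Rightarrow> 'a \<Rightarrow> 'a set" where
  "colon I g = {f. f * g \<in> I}"


section \<open>Linear quotients\<close>

definition minimal_monomial_generators :: "'n expo set \<Rightarrow> ('n, 'k::field) mpoly set \<Rightarrow> bool" where
  "minimal_monomial_generators U J \<longleftrightarrow>
     ideal.span (monomial ` U) = J \<and> (\<forall>T. T \<subset> U \<longrightarrow> ideal.span (monomial ` T) \<noteq> J)"

definition has_linear_quotients :: "('n, 'k::field) mpoly set \<Rightarrow> bool" where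
  "has_linear_quotients (J :: ('n, 'k) mpoly set) \<longleftrightarrow>
     (\<exists>us. distinct us \<and> minimal_monomial_generators (set us) J \<and>
        (\<forall>i. 1 \<le> i \<and> i < length us \<longrightarrow>
           (\<exists>V. colon (ideal.span (monomial ` set (take i us))) (monomial (us ! i))
                = (ideal.span (var ` V) :: ('n, 'k) mpoly set))))"


section \<open>Minimal multigraded free resolutions and homological shift ideals\<close>

text \<open>
  A finitely generated graded free module \<open>\<Oplus>\<^sub>j R(-a\<^sub>j)\<close> is represented by the list of the degrees
  \<open>a\<^sub>j\<close> of its basis elements; its elements are coordinate vectors, functions vanishing beyond
  the rank.
\<close>

definition free_module :: "nat \<Rightarrow> (nat \<Rightarrow> ('n, 'k::field) mpoly) set" where
  "free_module r = {v. \<forall>j\<ge>r. v j = 0}"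

definition mat_map :: "nat \<Rightarrow> nat \<Rightarrow> (nat \<Rightarrow> nat \<Rightarrow> ('n, 'k::field) mpoly)
    \<Rightarrow> (nat \<Rightarrow> ('n, 'k) mpoly) \<Rightarrow> (nat \<Rightarrow> ('n, 'k) mpoly)" where
  "mat_map p q M v = (\<lambda>i. if i < p then \<Sum>j<q. M i j * v j else 0)"

text \<open>
  \<open>f\<close> is a scalar multiple of \<open>x\<^sup>c\<close> with \<open>a + c = b\<close> (and zero if there is no such \<open>c\<close>), that is,
  multiplication by \<open>f\<close> is a homogeneous map of degree zero from \<open>R(-b)\<close> to \<open>R(-a)\<close>.
\<close>

definition degree_zero_map :: "'n expo \<Rightarrow> 'n expo \<Rightarrow> ('n, 'k::field) mpoly \<Rightarrow> bool" where
  "degree_zero_map b a f \<longleftrightarrow> (\<forall>c \<in> Poly_Mapping.keys f. a + c = b)"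

text \<open>
  The complex \<open>\<dots> \<rightarrow> F\<^sub>1 \<rightarrow> F\<^sub>0 \<rightarrow> J \<rightarrow> 0\<close>, where \<open>F k\<close> lists the basis degrees of the \<open>k\<close>th module,
  \<open>d k\<close> is the matrix of the map from the \<open>(k+1)\<close>st to the \<open>k\<close>th module, and \<open>e\<close> is the row of
  the augmentation map onto \<open>J\<close>.
\<close>

definition graded_free_resolution :: "('n, 'k::field) mpoly set \<Rightarrow> (nat \<Rightarrow> 'n expo list)
    \<Rightarrow> (nat \<Rightarrow> nat \<Rightarrow> nat \<Rightarrow> ('n, 'k) mpoly) \<Rightarrow> (nat \<Rightarrow> ('n, 'k) mpoly) \<Rightarrow> bool" where
  "graded_free_resolution J F d e \<longleftrightarrow>
     (let r = (\<lambda>k. length (F k));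
          aug = (\<lambda>v. \<Sum>j<r 0. e j * v j);
          D = (\<lambda>k. mat_map (r k) (r (Suc k)) (d k))
      in (\<forall>j<r 0. degree_zero_map (F 0 ! j) 0 (e j)) \<and>
         (\<forall>k. \<forall>i<r k. \<forall>j<r (Suc k). degree_zero_map (F (Suc k) ! j) (F k ! i) (d k i j)) \<and>
         aug ` free_module (r 0) = J \<and>
         {v \<in> free_module (r 0). aug v = 0} = D 0 ` free_module (r 1) \<and>
         (\<forall>k. {v \<in> free_module (r (Suc k)). D k v = (\<lambda>_. 0)}
              = D (Suc k) ` free_module (r (Suc (Suc k)))))"

definition minimal_graded_free_resolution :: "('n, 'k::field) mpoly set \<Rightarrow> (nat \<Rightarrow> 'n expo list)
    \<Rightarrow> (nat \<Rightarrow> nat \<Rightarrow> nat \<Rightarrow> ('n, 'k) mpoly) \<Rightarrow> (nat \<Rightarrow> ('n, 'k) mpoly) \<Rightarrow> bool" where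
  "minimal_graded_free_resolution J F d e \<longleftrightarrow>
     graded_free_resolution J F d e \<and>
     (\<forall>k. \<forall>i<length (F k). \<forall>j<length (F (Suc k)). d k i j \<in> ideal.span (range var))"

text \<open>
  Every monomial ideal has a minimal graded free resolution, unique up to graded isomorphism, so
  the multiset of basis degrees in each homological degree does not depend on the choice.
\<close>

definition betti :: "('n, 'k::field) mpoly set \<Rightarrow> nat \<Rightarrow> 'n expo \<Rightarrow> nat" where
  "betti J k a =
     count_list ((SOME F. \<exists>d e. minimal_graded_free_resolution J F d e) k) a"

definition HS :: "nat \<Rightarrow> ('n, 'k::field) mpoly set \<Rightarrow> ('n, 'k) mpoly set" where
  "HS k J = ideal.span {monomial a | a. betti J k a \<noteq> 0}"


section \<open>Weighted oriented graphs and edge ideals\<close>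

text \<open>
  The vertex set is the whole type \<open>'n\<close>, and \<open>(i, j) \<in> E\<close> is an edge oriented from \<open>i\<close> to \<open>j\<close>.
  Asymmetry of \<open>E\<close> (which includes irreflexivity) says that \<open>E\<close> arises from a simple graph by
  giving each edge exactly one orientation.
\<close>

definition weighted_oriented_graph :: "('n \<times> 'n) set \<Rightarrow> ('n \<Rightarrow> nat) \<Rightarrow> bool" where
  "weighted_oriented_graph E w \<longleftrightarrow>
     asym E \<and> (\<forall>i. w i \<ge> 1) \<and> (\<forall>j. (\<forall>i. (i, j) \<notin> E) \<longrightarrow> w j = 1)"

definition underlying_graph :: "('n \<times> 'n) set \<Rightarrow> 'n set set" where
  "underlying_graph E = {{i, j} | i j. (i, j) \<in> E}"

definition weighted_edge_ideal :: "('n \<times> 'n) set \<Rightarrow> ('n \<Rightarrow> nat) \<Rightarrow> ('n, 'k::field) mpoly set" where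
  "weighted_edge_ideal E w = ideal.span {var i * var j ^ w j | i j. (i, j) \<in> E}"

definition edge_ideal :: "'n set set \<Rightarrow> ('n, 'k::field) mpoly set" where
  "edge_ideal G = ideal.span {var i * var j | i j. {i, j} \<in> G}"

end

theory Submission
  imports Defs
begin

text \<open>
  Let \<open>u\<^sub>1, \<dots>, u\<^sub>m\<close> be the generators of \<open>I(D)\<close> in a linear quotient order and \<open>S\<^sub>p\<close> the set of variables
  generating the \<open>p\<close>th colon ideal. Iterated mapping cones over Koszul complexes resolve \<open>I(D)\<close> by free
  modules with a basis element of degree \<open>u\<^sub>p x\<^sub>F\<close> in homological degree \<open>|F|\<close> for every \<open>F \<subseteq> S\<^sub>p\<close>. Since
  two edges differ in their vertex sets, \<open>S\<^sub>p\<close> avoids the two variables of \<open>u\<^sub>p\<close>; thus \<open>u\<^sub>p x\<^sub>F\<close> has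
  \<open>|F| + 2\<close> variables, basis elements in adjacent homological degrees never have the same multidegree,
  and the resolution is minimal without any assumption on the degrees of the \<open>u\<^sub>p\<close>. As two minimal
  resolutions have the same degrees, \<open>HS\<^sub>k\<close> is generated by the \<open>u\<^sub>p x\<^sub>F\<close> with \<open>|F| = k\<close>. For the same reason
  the sets \<open>S\<^sub>p\<close> also generate the colon ideals of the radicals of the \<open>u\<^sub>p\<close>, which are the generators of
  \<open>I(G)\<close>, so passing to radicals of the generators turns \<open>HS\<^sub>k(I(D))\<close> into \<open>HS\<^sub>k(I(G))\<close>.
\<close>

section \<open>Linear extension\<close>

text \<open>\<open>betti\<close> rests on an arbitrary choice among the minimal resolutions, so two
  things are needed: that there is one, and that any one has the degrees of the mapping cone.
  Exactness may be tested one multidegree at a time, where free modules become finite-dimensional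
  vector spaces and matrices become scalar; the comparison is carried out there, and a translation
  in both directions connects it with modules over the polynomial ring. \<open>HS\<close> only asks
  whether a Betti number vanishes, so it suffices to compare the sets of degrees, without
  multiplicities. A cone adds the generator \<open>u p\<close> because its colon ideal, multiplied
  by \<open>u p\<close>, is the intersection of the ideal of the earlier generators with the ideal
  of \<open>u p\<close>: the Koszul complex on \<open>S p\<close>, shifted by \<open>u p\<close>,
  resolves the quotient by this intersection. The same gluing, with variables as generators, builds
  the Koszul complex itself. This is why a \<open>based_resolution\<close> may start in any
  homological degree and any multidegree.\<close>

abbreviation lookup where "lookup \<equiv> Poly_Mapping.lookup"
abbreviation keys where "keys \<equiv> Poly_Mapping.keys"
abbreviation single where "single \<equiv> Poly_Mapping.single"

text \<open>The index type need not carry an addition, so scalars cannot act by convolution as in a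
  polynomial ring.\<close>

definition scl :: "'k::field \<Rightarrow> ('b \<Rightarrow>\<^sub>0 'k) \<Rightarrow> ('b \<Rightarrow>\<^sub>0 'k)" where
  "scl c v = Poly_Mapping.map ((*) c) v"

definition lin :: "('b \<Rightarrow> 'c \<Rightarrow>\<^sub>0 'k::field) \<Rightarrow> ('b \<Rightarrow>\<^sub>0 'k) \<Rightarrow> ('c \<Rightarrow>\<^sub>0 'k)" where
  "lin f v = (\<Sum>j\<in>keys v. scl (lookup v j) (f j))"

lemma lookup_scl [simp]: "lookup (scl c v) i = c * lookup v i"
  by (simp add: scl_def map.rep_eq when_def)

lemma lookup_lin_superset:
  assumes "finite A" "keys v \<subseteq> A"
  shows "lookup (lin f v) i = (\<Sum>j\<in>A. lookup v j * lookup (f j) i)"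
  unfolding lin_def lookup_sum lookup_scl
  using assms by (intro sum.mono_neutral_left) (auto simp: in_keys_iff)

lemma lookup_lin: "lookup (lin f v) i = (\<Sum>j\<in>keys v. lookup v j * lookup (f j) i)"
  by (simp add: lookup_lin_superset)

lemma keys_lin: "i \<in> keys (lin f v) \<Longrightarrow> \<exists>j\<in>keys v. i \<in> keys (f j)"
  by (rule ccontr) (simp add: in_keys_iff lookup_lin)

lemma keys_scl: "keys (scl c v) \<subseteq> keys v"
  by (auto simp: in_keys_iff)

lemma lin_add: "lin f (u + v) = lin f u + lin f v"
proof (rule poly_mapping_eqI)
  fix i
  have A: "finite (keys u \<union> keys v)" "keys (u + v) \<subseteq> keys u \<union> keys v"
    by (simp_all add: keys_add)
  show "lookup (lin f (u + v)) i = lookup (lin f u + lin f v) i"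
    unfolding lookup_add lookup_lin_superset[OF A] lookup_lin_superset[OF A(1) Un_upper1]
      lookup_lin_superset[OF A(1) Un_upper2] by (simp add: sum.distrib ring_distribs)
qed

lemma lin_scl: "lin f (scl c v) = scl c (lin f v)"
proof (rule poly_mapping_eqI)
  fix i
  show "lookup (lin f (scl c v)) i = lookup (scl c (lin f v)) i"
    unfolding lookup_lin_superset[OF finite_keys keys_scl]
    unfolding lookup_scl lookup_lin
    by (simp only: sum_distrib_left mult.assoc)
qed

lemma lin_zero [simp]: "lin f 0 = 0"
  by (simp add: lin_def)

lemma scl_zero [simp]: "scl c 0 = 0" "scl 0 v = 0"
  by (rule poly_mapping_eqI, simp)+

lemma scl_one [simp]: "scl 1 v = v"
  by (rule poly_mapping_eqI) simp

lemma scl_minus_one [simp]: "scl (- 1) v = - v"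
  by (rule poly_mapping_eqI) simp

lemma lin_single [simp]: "lin f (single j c) = scl c (f j)"
  by (simp add: lin_def)

lemma lin_uminus: "lin f (- v) = - lin f v"
  using lin_scl[of f "- 1" v] by simp

lemma lin_minus: "lin f (u - v) = lin f u - lin f v"
  using lin_add[of f u "- v"] by (simp add: lin_uminus)

lemma scl_single [simp]: "scl c (single j d) = single j (c * d)"
  by (rule poly_mapping_eqI) (simp add: lookup_single when_def)

lemma lin_sum: "lin f (sum g A) = (\<Sum>a\<in>A. lin f (g a))"
  by (induction A rule: infinite_finite_induct) (simp_all add: lin_add)

lemma lin_cong: "(\<And>j. j \<in> keys v \<Longrightarrow> f j = g j) \<Longrightarrow> lin f v = lin g v"
  by (simp add: lin_def)

lemma lin_lin: "lin f (lin g v) = lin (\<lambda>j. lin f (g j)) v"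
  by (simp add: lin_def[of g] lin_def[of "\<lambda>j. lin f (g j)"] lin_sum lin_scl)

lemma lin_fun_zero [simp]: "lin (\<lambda>j. 0) v = 0"
  by (simp add: lin_def)

lemma lin_eq_0: "(\<And>j. j \<in> keys v \<Longrightarrow> f j = 0) \<Longrightarrow> lin f v = 0"
  by (simp add: lin_def)

lemma lin_fun_add: "lin (\<lambda>j. f j + g j) v = lin f v + lin g v"
  by (rule poly_mapping_eqI) (simp only: lookup_lin lookup_add sum.distrib distrib_left)

lemma lin_fun_scl: "lin (\<lambda>j. scl c (f j)) v = scl c (lin f v)"
  by (rule poly_mapping_eqI) (simp only: lookup_scl lookup_lin sum_distrib_left mult.left_commute[of _ c])

lemma lin_fun_minus: "lin (\<lambda>j. f j - g j) v = lin f v - lin g v"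
  by (rule poly_mapping_eqI) (simp only: lookup_lin lookup_minus sum_subtractf right_diff_distrib)

lemma lin_fun_single [simp]: "lin (\<lambda>j. single j 1) v = v"
proof (rule poly_mapping_eqI)
  fix i
  show "lookup (lin (\<lambda>j. single j 1) v) i = lookup v i"
    by (subst lookup_lin_superset[of "insert i (keys v)"])
      (auto simp: lookup_single when_def sum.remove[of _ i])
qed

section \<open>Divisibility of monomials\<close>

definition mdvd :: "'n expo \<Rightarrow> 'n expo \<Rightarrow> bool" (infix "\<preceq>" 50) where
  "a \<preceq> b \<longleftrightarrow> (\<forall>i. lookup a i \<le> lookup b i)"

lemma mdvd_refl [simp, intro]: "a \<preceq> a"
  by (simp add: mdvd_def)

lemma mdvd_trans [trans]: "a \<preceq> b \<Longrightarrow> b \<preceq> c \<Longrightarrow> a \<preceq> c"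
  unfolding mdvd_def using le_trans by blast

lemma mdvd_antisym: "a \<preceq> b \<Longrightarrow> b \<preceq> a \<Longrightarrow> a = b"
  unfolding mdvd_def by (intro poly_mapping_eqI antisym) auto

lemma mdvd_add_diff: "a \<preceq> b \<Longrightarrow> a + (b - a) = b"
  by (rule poly_mapping_eqI) (simp add: mdvd_def lookup_add lookup_minus)

lemma mdvd_iff_add: "a \<preceq> b \<longleftrightarrow> (\<exists>c. a + c = b)"
proof
  show "a \<preceq> b \<Longrightarrow> \<exists>c. a + c = b"
    using mdvd_add_diff by blast
qed (auto simp: mdvd_def lookup_add)

lemma mdvd_add [simp, intro]: "a \<preceq> a + c"
  by (auto simp: mdvd_iff_add)

lemma zero_mdvd [simp, intro]: "0 \<preceq> a"
  by (simp add: mdvd_def)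

section \<open>Complexes with a homogeneous basis\<close>

text \<open>
  A multigraded complex of free modules with a homogeneous basis is the same thing as a complex of
  vector spaces with a basis whose elements carry degrees, such that the boundary of a basis element
  \<open>j\<close> only involves basis elements of degree dividing that of \<open>j\<close>. The piece in degree \<open>a\<close> of the
  former is the span of the basis elements of degree dividing \<open>a\<close> in the latter.
  Below, \<open>B\<close> is the basis in all homological degrees, \<open>h\<close> gives the homological degree,
  \<open>\<delta>\<close> the multidegree and \<open>bd\<close> the boundary.
\<close>

definition strand :: "('b \<Rightarrow> nat) \<Rightarrow> ('b \<Rightarrow> 'n expo) \<Rightarrow> 'b set \<Rightarrow> nat \<Rightarrow> 'n expo
    \<Rightarrow> ('b \<Rightarrow>\<^sub>0 'k::field) set" where
  "strand h \<delta> B k a = {v. \<forall>j\<in>keys v. j \<in> B \<and> h j = k \<and> \<delta> j \<preceq> a}"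

definition based_complex :: "('b \<Rightarrow> nat) \<Rightarrow> ('b \<Rightarrow> 'n expo) \<Rightarrow> 'b set
    \<Rightarrow> ('b \<Rightarrow> 'b \<Rightarrow>\<^sub>0 'k::field) \<Rightarrow> bool" where
  "based_complex h \<delta> B bd \<longleftrightarrow> (\<forall>j\<in>B. lin bd (bd j) = 0 \<and>
     (\<forall>i\<in>keys (bd j). i \<in> B \<and> Suc (h i) = h j \<and> \<delta> i \<preceq> \<delta> j))"

text \<open>Degrees outside \<open>J\<close> are left out on purpose: in a
  \<open>based_resolution\<close> all basis elements except \<open>z\<close> have degrees in
  \<open>J\<close>, so there the strand is spanned by \<open>z\<close> at most, and its homology is
  what the quotient by \<open>J\<close> requires.\<close>

definition acyclic_on :: "('b \<Rightarrow> nat) \<Rightarrow> ('b \<Rightarrow> 'n expo) \<Rightarrow> 'b set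
    \<Rightarrow> ('b \<Rightarrow> 'b \<Rightarrow>\<^sub>0 'k::field) \<Rightarrow> 'n expo set \<Rightarrow> bool" where
  "acyclic_on h \<delta> B bd J \<longleftrightarrow> (\<forall>a\<in>J. \<forall>k. \<forall>v\<in>strand h \<delta> B k a. lin bd v = 0
     \<longrightarrow> (\<exists>y\<in>strand h \<delta> B (Suc k) a. lin bd y = v))"

text \<open>
  The complex resolves the quotient of \<open>R(-\<delta> z)\<close> by the monomials with exponents in \<open>J\<close>;
  the basis element \<open>z\<close> generates its lowest term.
\<close>

definition based_resolution :: "('b \<Rightarrow> nat) \<Rightarrow> ('b \<Rightarrow> 'n expo) \<Rightarrow> 'b set
    \<Rightarrow> ('b \<Rightarrow> 'b \<Rightarrow>\<^sub>0 'k::field) \<Rightarrow> 'b \<Rightarrow> 'n expo set \<Rightarrow> bool" where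
  "based_resolution h \<delta> B bd z J \<longleftrightarrow>
     based_complex h \<delta> B bd \<and> acyclic_on h \<delta> B bd J \<and> z \<in> B \<and>
     (\<forall>j\<in>B. j \<noteq> z \<longrightarrow> \<delta> j \<in> J \<and> h z < h j) \<and>
     (\<forall>a\<in>J. \<delta> z \<preceq> a) \<and> (\<forall>a\<in>J. \<forall>b. a \<preceq> b \<longrightarrow> b \<in> J)"

lemma based_resolutionD:
  assumes "based_resolution h \<delta> B bd z J"
  shows "based_complex h \<delta> B bd" "acyclic_on h \<delta> B bd J" "z \<in> B"
    "\<And>j. j \<in> B \<Longrightarrow> j \<noteq> z \<Longrightarrow> \<delta> j \<in> J" "\<And>j. j \<in> B \<Longrightarrow> j \<noteq> z \<Longrightarrow> h z < h j"
    "\<And>a. a \<in> J \<Longrightarrow> \<delta> z \<preceq> a" "\<And>a b. a \<in> J \<Longrightarrow> a \<preceq> b \<Longrightarrow> b \<in> J"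
  using assms unfolding based_resolution_def by blast+

lemma strandD: "v \<in> strand h \<delta> B k a \<Longrightarrow> j \<in> keys v \<Longrightarrow> j \<in> B \<and> h j = k \<and> \<delta> j \<preceq> a"
  by (simp add: strand_def)

lemma strand_zero [simp]: "0 \<in> strand h \<delta> B k a"
  by (simp add: strand_def)

lemma strand_mono: "v \<in> strand h \<delta> B k a \<Longrightarrow> a \<preceq> b \<Longrightarrow> v \<in> strand h \<delta> B k b"
  unfolding strand_def using mdvd_trans by blast

lemma strand_add:
  "u \<in> strand h \<delta> B k a \<Longrightarrow> v \<in> strand h \<delta> B k a \<Longrightarrow> u + v \<in> strand h \<delta> B k a"
  unfolding strand_def by (auto dest!: subsetD[OF keys_add])

lemma strand_minus:
  "u \<in> strand h \<delta> B k a \<Longrightarrow> v \<in> strand h \<delta> B k a \<Longrightarrow> u - v \<in> strand h \<delta> B k a"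
  unfolding strand_def by (auto dest!: subsetD[OF keys_diff])

lemma strand_scl: "v \<in> strand h \<delta> B k a \<Longrightarrow> scl c v \<in> strand h \<delta> B k a"
  unfolding strand_def by (auto dest!: subsetD[OF keys_scl])

lemma strand_single: "j \<in> B \<Longrightarrow> single j c \<in> strand h \<delta> B (h j) (\<delta> j)"
  by (simp add: strand_def)

lemma strand_lin:
  assumes "\<And>j. j \<in> keys v \<Longrightarrow> f j \<in> strand h \<delta> B k a"
  shows "lin f v \<in> strand h \<delta> B k a"
  using assms unfolding strand_def by (fastforce dest: keys_lin)

lemma lin_boundary_boundary:
  assumes "based_complex h \<delta> B bd" "v \<in> strand h \<delta> B k a"
  shows "lin bd (lin bd v) = 0"
  unfolding lin_lin
  by (rule lin_eq_0) (use assms in \<open>auto dest: strandD simp: based_complex_def\<close>)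

text \<open>\<open>z\<close> sits in the lowest homological degree, so its boundary has nowhere to
  go.\<close>

lemma resolution_least:
  assumes "based_resolution h \<delta> B bd z J"
  shows "bd z = 0"
proof -
  have "i \<notin> keys (bd z)" for i
    using assms unfolding based_resolution_def based_complex_def
    by (metis Suc_n_not_le_n less_Suc_eq_le less_le lessI)
  then have "keys (bd z) = {}" by blast
  then show ?thesis by simp
qed

text \<open>
  If \<open>g = 0\<close> away from \<open>z\<close>, then \<open>s\<close> is a chain map (\<open>\<epsilon> = 1\<close>) or an anticommuting one (\<open>\<epsilon> = - 1\<close>);
  if \<open>g\<close> is a chain map with \<open>g z = 0\<close> and \<open>\<epsilon> = - 1\<close>, then \<open>s\<close> is a null-homotopy of \<open>g\<close>.
\<close>

lemma lift_along_acyclic: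
  fixes g :: "'b \<Rightarrow> 'c \<Rightarrow>\<^sub>0 'k::field" and bdX :: "'b \<Rightarrow> 'b \<Rightarrow>\<^sub>0 'k"
  assumes X: "based_resolution hX \<delta>X X bdX z J'" and "J' \<subseteq> J"
    and Y: "based_complex hY \<delta>Y Y bdY" "acyclic_on hY \<delta>Y Y bdY J"
    and g: "\<And>j k. j \<in> X \<Longrightarrow> j \<noteq> z \<Longrightarrow> Suc k = r + (hX j - hX z) \<Longrightarrow> g j \<in> strand hY \<delta>Y Y k (\<delta>X j)"
    and cond: "\<And>j. j \<in> X \<Longrightarrow> j \<noteq> z \<Longrightarrow> lin bdY (g j) + scl \<epsilon> (lin g (bdX j)) = 0"
    and y0: "y0 \<in> strand hY \<delta>Y Y r (\<delta>X z)" "lin bdY y0 = g z"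
  shows "\<exists>s. s z = y0 \<and> (\<forall>j\<in>X. s j \<in> strand hY \<delta>Y Y (r + (hX j - hX z)) (\<delta>X j) \<and>
            lin bdY (s j) = g j + scl \<epsilon> (lin s (bdX j)))"
proof -
  have cX: "based_complex hX \<delta>X X bdX" and oX: "z \<in> X" and
    dX: "\<And>j. j \<in> X \<Longrightarrow> j \<noteq> z \<Longrightarrow> \<delta>X j \<in> J \<and> hX z < hX j"
    using X \<open>J' \<subseteq> J\<close> by (auto simp: based_resolution_def)
  have key: "i \<in> X \<and> Suc (hX i) = hX j \<and> \<delta>X i \<preceq> \<delta>X j" if "j \<in> X" "i \<in> keys (bdX j)" for i j
    using cX that by (auto simp: based_complex_def)
  have ge: "hX z \<le> hX j" if "j \<in> X" for j
    using dX[OF that] by force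
  \<comment> \<open>The condition on \<open>s j\<close> refers to \<open>s i\<close> only for
    \<open>i\<close> in \<open>keys (bdX j)\<close>, one level lower, so \<open>s\<close> can be
    chosen by recursion on the homological degree.\<close>
  define P where "P s j y \<longleftrightarrow> (j = z \<longrightarrow> y = y0) \<and>
      (j \<in> X \<longrightarrow> y \<in> strand hY \<delta>Y Y (r + (hX j - hX z)) (\<delta>X j) \<and>
            lin bdY y = g j + scl \<epsilon> (lin s (bdX j)))" for s j y
  have "\<exists>s. \<forall>j. P s j (s j)"
  proof (rule dependent_wf_choice[of "measure hX"])
    show "P f x y = P f' x y" if "\<And>z. (z, x) \<in> measure hX \<Longrightarrow> f z = f' z" for f f' x y
    proof (cases "x \<in> X")
      case True
      then have "lin f (bdX x) = lin f' (bdX x)"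
        using that key by (intro lin_cong) fastforce
      then show ?thesis by (simp add: P_def)
    qed (simp add: P_def)
  next
    fix j s
    assume IH: "\<And>i. (i, j) \<in> measure hX \<Longrightarrow> P s i (s i)"
    consider "j \<notin> X" | "j = z" | "j \<in> X" "j \<noteq> z" by blast
    then show "\<exists>y. P s j y"
    proof cases
      case 2
      have "bdX z = 0"
        using resolution_least[OF X] .
      then show ?thesis
        using y0 2 by (intro exI[of _ y0]) (simp add: P_def)
    next
      case 3
      \<comment> \<open>\<open>r\<close> is the level of \<open>s z\<close>, so \<open>s j\<close>
        must lie in level \<open>Suc k\<close> and its boundary in level \<open>k\<close>.\<close>
      obtain k where k: "Suc k = r + (hX j - hX z)"
        using dX[OF 3] by (metis add_Suc_right Suc_diff_Suc)
      let ?v = "g j + scl \<epsilon> (lin s (bdX j))"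
      have s: "s i \<in> strand hY \<delta>Y Y k (\<delta>X j)" "lin bdY (s i) = g i + scl \<epsilon> (lin s (bdX i))"
        if "i \<in> keys (bdX j)" for i
      proof -
        have i: "i \<in> X" "Suc (hX i) = hX j" "\<delta>X i \<preceq> \<delta>X j"
          using key 3 that by auto
        then have "P s i (s i)" using IH by simp
        moreover have "r + (hX i - hX z) = k"
          using k i(2) ge[OF i(1)] by linarith
        ultimately show "s i \<in> strand hY \<delta>Y Y k (\<delta>X j)" "lin bdY (s i) = g i + scl \<epsilon> (lin s (bdX i))"
          using i by (auto simp: P_def intro: strand_mono)
      qed
      have "?v \<in> strand hY \<delta>Y Y k (\<delta>X j)"
        using g[OF 3 k] s(1) by (intro strand_add strand_scl strand_lin) auto
      \<comment> \<open>As \<open>bdX\<close> squares to zero, \<open>cond\<close> says exactly that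
        \<open>?v\<close> is a cycle; the degree of \<open>j\<close> lies in \<open>J\<close>, so it
        is a boundary.\<close>
      moreover have "lin bdY (lin s (bdX j)) = lin g (bdX j) + scl \<epsilon> (lin s (lin bdX (bdX j)))"
        unfolding lin_lin using s
        by (subst lin_cong[of _ _ "\<lambda>i. g i + scl \<epsilon> (lin s (bdX i))"])
          (simp_all add: lin_fun_add lin_fun_scl)
      then have "lin bdY ?v = 0"
        using cX 3 cond[OF 3] by (simp add: lin_add lin_scl based_complex_def)
      ultimately show ?thesis
        using Y(2) dX[OF 3] 3 unfolding acyclic_on_def P_def
        by (metis k)
    qed (simp add: P_def oX)
  qed simp
  then show ?thesis
    unfolding P_def by blast
qed

text \<open>The comparison theorem, as lifting with \<open>g = 0\<close>. Both signs are used: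
  \<open>\<epsilon> = 1\<close> to compare two resolutions, \<open>\<epsilon> = - 1\<close> for the
  connecting map of a cone. The inclusion of \<open>J'\<close> in \<open>J\<close> places the
  degrees of all basis elements other than \<open>z\<close> where \<open>Y\<close> is
  acyclic.\<close>

lemma chain_map_exists:
  fixes bdX :: "'b \<Rightarrow> 'b \<Rightarrow>\<^sub>0 'k::field" and bdY :: "'c \<Rightarrow> 'c \<Rightarrow>\<^sub>0 'k"
  assumes X: "based_resolution hX \<delta>X X bdX z J'" and "J' \<subseteq> J"
    and Y: "based_resolution hY \<delta>Y Y bdY z' J" and "\<delta>Y z' \<preceq> \<delta>X z"
  shows "\<exists>\<phi>. \<phi> z = single z' 1 \<and>
    (\<forall>j\<in>X. \<phi> j \<in> strand hY \<delta>Y Y (hY z' + (hX j - hX z)) (\<delta>X j) \<and>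
            lin bdY (\<phi> j) = scl \<epsilon> (lin \<phi> (bdX j)))"
proof -
  have Y': "based_complex hY \<delta>Y Y bdY" "acyclic_on hY \<delta>Y Y bdY J" "z' \<in> Y"
    using Y by (auto simp: based_resolution_def)
  have "single z' 1 \<in> strand hY \<delta>Y Y (hY z') (\<delta>X z)"
    using strand_mono[OF strand_single[OF Y'(3), of _ hY \<delta>Y] assms(4)] .
  from lift_along_acyclic[OF X \<open>J' \<subseteq> J\<close> Y'(1,2), of "hY z'" "\<lambda>_. 0" \<epsilon>, OF _ _ this] show ?thesis
    by (simp add: resolution_least[OF Y])
qed

text \<open>
  A null-homotopy of (the composite of the comparison maps minus the identity) has, by minimality,
  no component in the same degree.
\<close>

lemma minimal_resolution_degrees:
  fixes bdX :: "'b \<Rightarrow> 'b \<Rightarrow>\<^sub>0 'k::field" and bdY :: "'c \<Rightarrow> 'c \<Rightarrow>\<^sub>0 'k"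
  assumes X: "based_resolution hX \<delta>X X bdX z J" and Y: "based_resolution hY \<delta>Y Y bdY z' J"
    and z: "hX z = 0" "hY z' = 0" "\<delta>X z = \<delta>Y z'"
    and min: "\<And>j i. j \<in> X \<Longrightarrow> i \<in> keys (bdX j) \<Longrightarrow> \<delta>X i \<noteq> \<delta>X j"
    and j: "j \<in> X"
  shows "\<exists>i\<in>Y. hY i = hX j \<and> \<delta>Y i = \<delta>X j"
proof (rule ccontr)
  assume no: "\<not> ?thesis"
  have cX: "based_complex hX \<delta>X X bdX" "acyclic_on hX \<delta>X X bdX J" "z \<in> X"
    using X by (auto simp: based_resolution_def)
  obtain \<phi> where \<phi>: "\<phi> z = single z' 1"
    "\<And>j. j \<in> X \<Longrightarrow> \<phi> j \<in> strand hY \<delta>Y Y (hX j) (\<delta>X j) \<and> lin bdY (\<phi> j) = lin \<phi> (bdX j)"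
    using chain_map_exists[OF X subset_refl Y, of 1] z by auto
  obtain \<psi> where \<psi>: "\<psi> z' = single z 1"
    "\<And>j. j \<in> Y \<Longrightarrow> \<psi> j \<in> strand hX \<delta>X X (hY j) (\<delta>Y j) \<and> lin bdX (\<psi> j) = lin \<psi> (bdY j)"
    using chain_map_exists[OF Y subset_refl X, of 1] z by auto
  define \<theta> where "\<theta> j = lin \<psi> (\<phi> j) - single j 1" for j
  have \<theta>_strand: "\<theta> j \<in> strand hX \<delta>X X (hX j) (\<delta>X j)" if "j \<in> X" for j
    unfolding \<theta>_def
  proof (intro strand_minus strand_lin strand_single that)
    fix i assume "i \<in> keys (\<phi> j)"
    then have "i \<in> Y" "hY i = hX j" "\<delta>Y i \<preceq> \<delta>X j"
      using \<phi>(2)[OF that] by (auto dest: strandD)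
    then show "\<psi> i \<in> strand hX \<delta>X X (hX j) (\<delta>X j)"
      using \<psi>(2) strand_mono by fastforce
  qed
  have \<theta>_chain: "lin bdX (\<theta> j) = lin \<theta> (bdX j)" if "j \<in> X" for j
  proof -
    have "lin bdX (lin \<psi> (\<phi> j)) = lin \<psi> (lin bdY (\<phi> j))"
      unfolding lin_lin using \<phi>(2)[OF that] \<psi>(2) by (intro lin_cong) (auto dest: strandD)
    also have "\<dots> = lin (\<lambda>j. lin \<psi> (\<phi> j)) (bdX j)"
      using \<phi>(2)[OF that] by (simp add: lin_lin)
    finally show ?thesis
      by (simp add: \<theta>_def[abs_def] lin_minus lin_fun_minus)
  qed
  have "\<theta> z = 0"
    by (simp add: \<theta>_def \<phi> \<psi>)
  \<comment> \<open>\<open>r = 1\<close> and \<open>y0 = 0\<close>: a homotopy raises the level by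
    one and may start with zero because \<open>\<theta> z = 0\<close>.\<close>
  then obtain s where s: "\<And>j. j \<in> X \<Longrightarrow> s j \<in> strand hX \<delta>X X (Suc (hX j)) (\<delta>X j) \<and>
      lin bdX (s j) = \<theta> j + scl (- 1) (lin s (bdX j))"
    using lift_along_acyclic[OF X subset_refl cX(1,2), of 1 \<theta> "- 1" 0] \<theta>_strand \<theta>_chain z by auto
  \<comment> \<open>A path from \<open>j\<close> through \<open>\<phi>\<close> and
    \<open>\<psi>\<close> back to \<open>j\<close> passes some \<open>i\<close> of the same level
    whose degree divides that of \<open>j\<close> and is divided by it; \<open>no\<close> excludes
    this. So the identity leaves - 1 on the diagonal of \<open>\<theta>\<close>, while the homotopy
    formula leaves 0.\<close>
  have "lookup (lin \<psi> (\<phi> j)) j = 0"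
  proof (rule ccontr)
    assume "\<not> ?thesis"
    then obtain i where i: "i \<in> keys (\<phi> j)" "j \<in> keys (\<psi> i)"
      using keys_lin by (metis in_keys_iff)
    then show False
      using no \<phi>(2)[OF j] \<psi>(2) mdvd_antisym by (metis strandD)
  qed
  then have "lookup (\<theta> j) j = - 1"
    by (simp add: \<theta>_def lookup_minus)
  moreover have "lookup (lin bdX (s j)) j = 0"
  proof (rule ccontr)
    assume "\<not> ?thesis"
    then obtain i where i: "i \<in> keys (s j)" "j \<in> keys (bdX i)"
      using keys_lin by (metis in_keys_iff)
    then have "i \<in> X" "\<delta>X i \<preceq> \<delta>X j"
      using s[OF j] by (auto dest: strandD)
    moreover have "\<delta>X j \<preceq> \<delta>X i"
      using cX(1) i \<open>i \<in> X\<close> by (auto simp: based_complex_def)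
    ultimately show False
      using min i mdvd_antisym by metis
  qed
  moreover have "lookup (lin s (bdX j)) j = 0"
  proof (rule ccontr)
    assume "\<not> ?thesis"
    then obtain i where i: "i \<in> keys (bdX j)" "j \<in> keys (s i)"
      using keys_lin by (metis in_keys_iff)
    then have "i \<in> X" "\<delta>X i \<preceq> \<delta>X j"
      using cX(1) j by (auto simp: based_complex_def)
    moreover have "\<delta>X j \<preceq> \<delta>X i"
      using s[OF \<open>i \<in> X\<close>] i by (auto dest: strandD)
    ultimately show False
      using min[OF j i(1)] mdvd_antisym by metis
  qed
  ultimately show False
    using s[OF j] by (metis add.right_neutral lookup_add lookup_scl mult_zero_right neg_equal_0_iff_equal zero_neq_one)
qed

section \<open>Mapping cones and linear quotients\<close>

definition restr :: "'b set \<Rightarrow> ('b \<Rightarrow>\<^sub>0 'k::field) \<Rightarrow> ('b \<Rightarrow>\<^sub>0 'k)" where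
  "restr A = lin (\<lambda>j. if j \<in> A then single j 1 else 0)"

lemma restr_strand: "v \<in> strand h \<delta> B k a \<Longrightarrow> restr A v \<in> strand h \<delta> (A \<inter> B) k a"
  unfolding restr_def by (intro strand_lin) (auto simp: strand_def)

lemma restr_add_restr:
  assumes "keys v \<subseteq> X \<union> Y" "X \<inter> Y = {}"
  shows "restr X v + restr Y v = v"
  unfolding restr_def lin_fun_add[symmetric]
  by (subst lin_cong[of _ _ "\<lambda>j. single j 1"]) (use assms in auto)

lemma disjoint_keys_add_eq_0:
  assumes "u + v = 0" "keys u \<subseteq> X" "keys v \<subseteq> Y" "X \<inter> Y = {}"
  shows "u = 0 \<and> v = (0 :: 'b \<Rightarrow>\<^sub>0 'k::field)"
proof -
  have uv: "v = - u" using assms(1) by (simp add: eq_neg_iff_add_eq_0 add.commute)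
  then have "keys u \<subseteq> Y" using assms(3) by simp
  then have "keys u = {}" using assms(2,4) by blast
  then show ?thesis using uv by simp
qed

text \<open>With \<open>R(-a)\<close> for the ring shifted by \<open>a\<close>, multiplication by
  the monomial of \<open>\<delta> p - \<delta> z\<close> embeds \<open>R(-\<delta> p)\<close> modulo
  \<open>J \<inter> (\<delta> p)\<close> into \<open>R(-\<delta> z)\<close> modulo \<open>J\<close>,
  with cokernel the quotient by \<open>J + (\<delta> p)\<close>. The cone over a lift of this map
  resolves the cokernel. \<open>X\<close> already starts one level above \<open>Y\<close>, so the
  cone needs no further shift.\<close>

lemma mapping_cone_resolution:
  fixes bdX bdY :: "'b \<Rightarrow> 'b \<Rightarrow>\<^sub>0 'k::field"
  assumes X: "based_resolution h \<delta> X bdX p (J \<inter> {a. \<delta> p \<preceq> a})"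
    and Y: "based_resolution h \<delta> Y bdY z J"
    and disj: "X \<inter> Y = {}" and hp: "h p = Suc (h z)" and zp: "\<delta> z \<preceq> \<delta> p"
  shows "\<exists>bd :: 'b \<Rightarrow> 'b \<Rightarrow>\<^sub>0 'k. based_resolution h \<delta> (X \<union> Y) bd z (J \<union> {a. \<delta> p \<preceq> a})"
proof -
  note cX = based_resolutionD(1)[OF X] and aX = based_resolutionD(2)[OF X]
    and pX = based_resolutionD(3)[OF X]
  note cY = based_resolutionD(1)[OF Y] and aY = based_resolutionD(2)[OF Y]
    and zY = based_resolutionD(3)[OF Y] and bJ = based_resolutionD(6)[OF Y]
    and up = based_resolutionD(7)[OF Y]
  have dX: "\<delta> j \<in> J \<and> \<delta> p \<preceq> \<delta> j \<and> h p < h j" if "j \<in> X" "j \<noteq> p" for j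
    using based_resolutionD(4,5)[OF X that] by simp
  have dY: "\<delta> j \<in> J \<and> h z < h j" if "j \<in> Y" "j \<noteq> z" for j
    using based_resolutionD(4,5)[OF Y that] by simp
  \<comment> \<open>The sign - 1 makes \<open>\<phi>\<close> anticommute with the boundaries, so
    that the mixed terms in the square of \<open>bd\<close> cancel.\<close>
  obtain \<phi> where \<phi>p: "\<phi> p = single z 1" and \<phi>: "\<And>j. j \<in> X \<Longrightarrow>
      \<phi> j \<in> strand h \<delta> Y (h z + (h j - h p)) (\<delta> j) \<and> lin bdY (\<phi> j) = - lin \<phi> (bdX j)"
    using chain_map_exists[OF X Int_lower1 Y zp, of "- 1"] by auto
  have hX: "h p \<le> h j" if "j \<in> X" for j
    using dX[OF that] by force
  have \<phi>s: "\<phi> j \<in> strand h \<delta> Y k a" if "j \<in> X" "h j = Suc k" "\<delta> j \<preceq> a" for j k a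
  proof -
    have "h z + (h j - h p) = k" using hp that hX[OF that(1)] by linarith
    then show ?thesis using \<phi>[OF that(1)] strand_mono that(3) by metis
  qed
  define bd where "bd j = (if j \<in> X then bdX j + \<phi> j else bdY j)" for j
  have bdX: "lin bd v = lin bdX v + lin \<phi> v" if "keys v \<subseteq> X" for v
    unfolding lin_fun_add[symmetric] by (rule lin_cong) (use that in \<open>auto simp: bd_def\<close>)
  have bdY: "lin bd v = lin bdY v" if "keys v \<subseteq> Y" for v
    by (rule lin_cong) (use that disj in \<open>auto simp: bd_def\<close>)
  have kX: "keys v \<subseteq> X" if "v \<in> strand h \<delta> X k a" for v k a
    using that by (auto simp: strand_def)
  have kY: "keys v \<subseteq> Y" if "v \<in> strand h \<delta> Y k a" for v k a
    using that by (auto simp: strand_def)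
  have "lin bd (bd j) = 0 \<and> (\<forall>i\<in>keys (bd j). i \<in> X \<union> Y \<and> Suc (h i) = h j \<and> \<delta> i \<preceq> \<delta> j)"
    if "j \<in> X \<union> Y" for j
  proof (cases "j \<in> X")
    case True
    then obtain k where k: "h j = Suc k"
      using hX hp by (metis Suc_le_D)
    have b: "i \<in> X \<and> Suc (h i) = h j \<and> \<delta> i \<preceq> \<delta> j" if "i \<in> keys (bdX j)" for i
      using cX True that by (auto simp: based_complex_def)
    then have 1: "keys (bdX j) \<subseteq> X" by auto
    have f: "i \<in> Y \<and> Suc (h i) = h j \<and> \<delta> i \<preceq> \<delta> j" if "i \<in> keys (\<phi> j)" for i
      using strandD[OF \<phi>s[OF True k mdvd_refl] that] k by auto
    then have 2: "keys (\<phi> j) \<subseteq> Y" by auto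
    have "lin bd (bd j) = lin bdX (bdX j)"
      using \<phi>[OF True] True by (simp add: bd_def lin_add bdX[OF 1] bdY[OF 2])
    then have "lin bd (bd j) = 0"
      using cX True by (simp add: based_complex_def)
    moreover have "\<forall>i\<in>keys (bd j). i \<in> X \<union> Y \<and> Suc (h i) = h j \<and> \<delta> i \<preceq> \<delta> j"
      using b f True by (auto simp: bd_def dest!: subsetD[OF keys_add])
    ultimately show ?thesis by blast
  next
    case False
    then have j: "j \<in> Y" "bd j = bdY j" using that by (auto simp: bd_def)
    then have "\<forall>i\<in>keys (bd j). i \<in> Y \<and> Suc (h i) = h j \<and> \<delta> i \<preceq> \<delta> j" "lin bdY (bd j) = 0"
      using cY by (auto simp: based_complex_def)
    moreover from this have "keys (bd j) \<subseteq> Y" by auto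
    ultimately show ?thesis
      using bdY by auto
  qed
  then have cZ: "based_complex h \<delta> (X \<union> Y) bd"
    by (simp add: based_complex_def)
  have "\<exists>w\<in>strand h \<delta> (X \<union> Y) (Suc k) a. lin bd w = v"
    if a: "a \<in> J \<union> {a. \<delta> p \<preceq> a}" and v: "v \<in> strand h \<delta> (X \<union> Y) k a" and v0: "lin bd v = 0" for v k a
  proof -
    define x y where "x = restr X v" and "y = restr Y v"
    have x: "x \<in> strand h \<delta> X k a" and y: "y \<in> strand h \<delta> Y k a"
      using restr_strand[OF v, of X] restr_strand[OF v, of Y]
      by (auto simp: x_def y_def Int_absorb2 Int_absorb1)
    have vxy: "v = x + y"
      unfolding x_def y_def using v disj by (intro restr_add_restr[symmetric]) (auto simp: strand_def)
    have \<phi>x: "lin \<phi> v' \<in> strand h \<delta> Y k' a" if "v' \<in> strand h \<delta> X (Suc k') a" for v' k'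
      using that \<phi>s by (intro strand_lin) (auto dest: strandD)
    have kb: "keys (lin bdX x) \<subseteq> X" "keys (lin bdY y + lin \<phi> x) \<subseteq> Y"
    proof -
      show "keys (lin bdX x) \<subseteq> X"
        using cX kX[OF x] by (auto dest!: keys_lin simp: based_complex_def)
      have "i \<in> Y" if i: "i \<in> keys (lin \<phi> x)" for i
      proof -
        obtain j where "j \<in> X" "i \<in> keys (\<phi> j)"
          using keys_lin[OF i] kX[OF x] by auto
        then show ?thesis using \<phi> by (auto dest: strandD)
      qed
      moreover have "i \<in> Y" if "i \<in> keys (lin bdY y)" for i
        using keys_lin[OF that] cY kY[OF y] by (auto simp: based_complex_def)
      ultimately show "keys (lin bdY y + lin \<phi> x) \<subseteq> Y"
        by (auto dest!: subsetD[OF keys_add])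
    qed
    have "lin bdX x + (lin bdY y + lin \<phi> x) = 0"
      using v0 unfolding vxy by (simp add: lin_add bdX[OF kX[OF x]] bdY[OF kY[OF y]] algebra_simps)
    then have x0: "lin bdX x = 0" and y0: "lin bdY y + lin \<phi> x = 0"
      using disjoint_keys_add_eq_0[OF _ kb disj] by auto
    show ?thesis
    proof (cases "a \<in> J")
      case True
      have "\<exists>x'\<in>strand h \<delta> X (Suc k) a. lin bdX x' = x"
      proof (cases "\<delta> p \<preceq> a")
        case pa: True
        then show ?thesis
          using aX True x x0 by (auto simp: acyclic_on_def)
      next
        case False
        have "j \<notin> keys x" for j
        proof
          assume "j \<in> keys x"
          then have "j \<in> X" "\<delta> j \<preceq> a" using strandD[OF x] by auto
          then show False using dX False mdvd_trans by (cases "j = p") blast+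
        qed
        then have "keys x = {}" by blast
        then have "x = 0" by simp
        then show ?thesis by (intro bexI[of _ 0]) simp_all
      qed
      then obtain x' where x': "x' \<in> strand h \<delta> X (Suc k) a" "lin bdX x' = x" by blast
      have "lin bdY (lin \<phi> x') = - lin \<phi> x"
      proof -
        have "lin bdY (lin \<phi> x') = lin (\<lambda>j. scl (- 1) (lin \<phi> (bdX j))) x'"
          unfolding lin_lin by (rule lin_cong) (use kX[OF x'(1)] \<phi> in auto)
        also have "\<dots> = scl (- 1) (lin \<phi> (lin bdX x'))"
          by (simp only: lin_fun_scl lin_lin)
        finally show ?thesis
          using x'(2) by simp
      qed
      \<comment> \<open>\<open>y\<close> alone need not be a cycle: lifting \<open>x\<close> to
        \<open>x'\<close> already produces \<open>lin \<phi> x'\<close> in \<open>Y\<close>, and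
        only the rest of \<open>y\<close> has to be bounded.\<close>
      then have "lin bdY (y - lin \<phi> x') = 0"
        using y0 by (simp add: lin_minus)
      moreover have "y - lin \<phi> x' \<in> strand h \<delta> Y k a"
        using y \<phi>x[OF x'(1)] by (rule strand_minus)
      ultimately obtain y' where y': "y' \<in> strand h \<delta> Y (Suc k) a" "lin bdY y' = y - lin \<phi> x'"
        using aY True unfolding acyclic_on_def by blast
      have "lin bd (x' + y') = v"
        using x' y' by (simp add: lin_add bdX[OF kX[OF x'(1)]] bdY[OF kY[OF y'(1)]] vxy)
      moreover have "x' + y' \<in> strand h \<delta> (X \<union> Y) (Suc k) a"
        using x'(1) y'(1) by (auto simp: strand_def dest!: subsetD[OF keys_add])
      ultimately show ?thesis by blast
    next
      case False
      \<comment> \<open>Outside \<open>J\<close> only \<open>p\<close> and \<open>z\<close> can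
        survive, and the strand is the map of lines taking \<open>p\<close> to \<open>z\<close>, an
        isomorphism.\<close>
      have pa: "\<delta> p \<preceq> a" using a False by auto
      have xp: "j = p" "k = Suc (h z)" if "j \<in> keys x" for j
      proof -
        show "j = p" using strandD[OF x that] dX False up by blast
        then show "k = Suc (h z)" using strandD[OF x that] hp by simp
      qed
      have yz: "j = z" "k = h z" if "j \<in> keys y" for j
      proof -
        show "j = z" using strandD[OF y that] dY False up by blast
        then show "k = h z" using strandD[OF y that] by simp
      qed
      have xs: "x = single p (lookup x p)"
        by (rule poly_mapping_eqI) (use xp in \<open>auto simp: lookup_single when_def in_keys_iff\<close>)
      have ys: "y = single z (lookup y z)"
        by (rule poly_mapping_eqI) (use yz in \<open>auto simp: lookup_single when_def in_keys_iff\<close>)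
      show ?thesis
      proof (cases "k = h z")
        case True
        then have "x = 0"
          using xp(2) by (metis Suc_n_not_n all_not_in_conv keys_eq_empty)
        have "bdX p = 0" using resolution_least[OF X] .
        then have "lin bd (single p (lookup y z)) = single z (lookup y z)"
          using pX \<phi>p by (simp add: bd_def)
        then have "lin bd (single p (lookup y z)) = v"
          using ys \<open>x = 0\<close> vxy by simp
        moreover have "single p (lookup y z) \<in> strand h \<delta> (X \<union> Y) (Suc k) a"
          using pX hp pa True by (simp add: strand_def)
        ultimately show ?thesis by blast
      next
        case k: False
        then have "keys y = {}" using yz(2) by blast
        then have "y = 0" by simp
        then have "single z (lookup x p) = 0"
          using y0 xs \<phi>p by (metis add_0 lin_single lin_zero mult.right_neutral scl_single)
        then have "lookup x p = 0" by (metis lookup_single_eq lookup_zero)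
        then have "x = 0" using xs by simp
        then show ?thesis using \<open>y = 0\<close> vxy by (intro bexI[of _ 0]) simp_all
      qed
    qed
  qed
  then have "acyclic_on h \<delta> (X \<union> Y) bd (J \<union> {a. \<delta> p \<preceq> a})"
    unfolding acyclic_on_def by blast
  moreover have "\<forall>j\<in>X \<union> Y. j \<noteq> z \<longrightarrow> \<delta> j \<in> J \<union> {a. \<delta> p \<preceq> a} \<and> h z < h j"
    using dX dY hX hp by (metis (no_types, lifting) Suc_le_eq UnCI UnE mdvd_refl mem_Collect_eq)
  moreover have "\<forall>a\<in>J \<union> {a. \<delta> p \<preceq> a}. \<delta> z \<preceq> a"
    using bJ zp mdvd_trans by blast
  moreover have "\<forall>a\<in>J \<union> {a. \<delta> p \<preceq> a}. \<forall>b. a \<preceq> b \<longrightarrow> b \<in> J \<union> {a. \<delta> p \<preceq> a}"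
    using up mdvd_trans by blast
  ultimately show ?thesis
    using cZ zY unfolding based_resolution_def by blast
qed

section \<open>Koszul complexes and resolutions from linear quotients\<close>

definition sqfree :: "'n::finite set \<Rightarrow> 'n expo" where
  "sqfree F = (\<Sum>i\<in>F. single i 1)"

lemma lookup_sqfree: "lookup (sqfree F) i = (if i \<in> F then 1 else 0)"
  by (simp add: sqfree_def lookup_sum lookup_single when_def)

lemma keys_sqfree [simp]: "keys (sqfree F) = F"
  by (simp add: set_eq_iff in_keys_iff lookup_sqfree)

lemma sqfree_mdvd_iff: "sqfree F \<preceq> a \<longleftrightarrow> F \<subseteq> keys a"
  by (auto simp: mdvd_def lookup_sqfree in_keys_iff Suc_le_eq split: if_splits)

text \<open>\<open>u + sqfree (F \<union> G)\<close> is the exponent of the least common multiple of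
  the other two monomials.\<close>

lemma add_sqfree_Un_mdvd_iff:
  "u + sqfree (F \<union> G) \<preceq> a \<longleftrightarrow> u + sqfree F \<preceq> a \<and> u + sqfree G \<preceq> a"
proof -
  have "lookup (u + sqfree (F \<union> G)) i = max (lookup (u + sqfree F) i) (lookup (u + sqfree G) i)" for i
    by (simp add: lookup_add lookup_sqfree)
  then show ?thesis
    by (auto simp: mdvd_def)
qed

text \<open>
  The Koszul complex, as an iterated cone: the subsets of \<open>T \<union> S\<close> containing \<open>T\<close> split into those
  that contain a given element \<open>t\<close> of \<open>S\<close> and those that do not.
\<close>

lemma koszul_resolution:
  fixes S T :: "'n::finite set" and e :: "'n set \<Rightarrow> 'b"
  assumes h: "\<And>F. h (e F) = c + card F" and \<delta>: "\<And>F. \<delta> (e F) = u + sqfree F" and "inj e"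
    and "S \<inter> T = {}"
  shows "\<exists>bd :: 'b \<Rightarrow> 'b \<Rightarrow>\<^sub>0 'k::field. based_resolution h \<delta> (e ` {F. T \<subseteq> F \<and> F \<subseteq> T \<union> S}) bd (e T)
           {a. \<exists>s\<in>S. u + sqfree (insert s T) \<preceq> a}"
  using finite[of S] \<open>S \<inter> T = {}\<close>
proof (induction S arbitrary: T rule: finite_induct)
  case empty
  have "e ` {F. T \<subseteq> F \<and> F \<subseteq> T \<union> {}} = {e T}" by auto
  then show ?case
    by (intro exI[of _ "\<lambda>_. 0"]) (auto simp: based_resolution_def based_complex_def acyclic_on_def)
next
  case (insert t S)
  let ?X = "e ` {F. insert t T \<subseteq> F \<and> F \<subseteq> insert t T \<union> S}" and ?Y = "e ` {F. T \<subseteq> F \<and> F \<subseteq> T \<union> S}"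
  let ?J = "{a. \<exists>s\<in>S. u + sqfree (insert s T) \<preceq> a}"
  obtain bdX :: "'b \<Rightarrow> 'b \<Rightarrow>\<^sub>0 'k" where X: "based_resolution h \<delta> ?X bdX (e (insert t T))
      {a. \<exists>s\<in>S. u + sqfree (insert s (insert t T)) \<preceq> a}"
    using insert.IH[of "insert t T"] insert.hyps insert.prems by auto
  \<comment> \<open>The variables other than \<open>t\<close> generate their own colon ideal by
    \<open>t\<close>; in terms of least common multiples this is the intersection that a cone
    requires.\<close>
  have JX: "{a. \<exists>s\<in>S. u + sqfree (insert s (insert t T)) \<preceq> a} = ?J \<inter> {a. \<delta> (e (insert t T)) \<preceq> a}"
    using add_sqfree_Un_mdvd_iff[of u "insert _ T" "insert t T"] by (auto simp: \<delta> insert_commute[of t])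
  obtain bdY :: "'b \<Rightarrow> 'b \<Rightarrow>\<^sub>0 'k" where Y: "based_resolution h \<delta> ?Y bdY (e T) ?J"
    using insert.IH[of T] insert.prems by auto
  have "?X \<inter> ?Y = {}"
    using insert.hyps insert.prems by (auto simp: inj_eq[OF \<open>inj e\<close>])
  moreover have "h (e (insert t T)) = Suc (h (e T))"
    using insert.prems by (simp add: h)
  moreover have "\<delta> (e T) \<preceq> \<delta> (e (insert t T))"
    by (auto simp: \<delta> mdvd_def lookup_add lookup_sqfree)
  ultimately obtain bd :: "'b \<Rightarrow> 'b \<Rightarrow>\<^sub>0 'k" where
    "based_resolution h \<delta> (?X \<union> ?Y) bd (e T) (?J \<union> {a. \<delta> (e (insert t T)) \<preceq> a})"
    using mapping_cone_resolution[OF X[unfolded JX] Y] by blast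
  moreover have "?X \<union> ?Y = e ` {F. T \<subseteq> F \<and> F \<subseteq> T \<union> insert t S}"
    unfolding image_Un[symmetric] by (rule arg_cong[of _ _ "image e"]) blast
  moreover have "?J \<union> {a. \<delta> (e (insert t T)) \<preceq> a} = {a. \<exists>s\<in>insert t S. u + sqfree (insert s T) \<preceq> a}"
    by (auto simp: \<delta>)
  ultimately show ?case by auto
qed

text \<open>
  The basis element \<open>(Suc p, F)\<close> stands for the generator \<open>u p\<close> and the subset \<open>F\<close> of the set of
  variables generating the colon ideal \<open>(u 0, \<dots>, u (p - 1)) : u p\<close>; the element \<open>(0, {})\<close>
  generates \<open>R\<close>.
\<close>

definition lq_basis :: "nat \<Rightarrow> (nat \<Rightarrow> 'n set) \<Rightarrow> (nat \<times> 'n set) set" where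
  "lq_basis m S = insert (0, {}) {(Suc p, F) | p F. p < m \<and> F \<subseteq> S p}"

text \<open>Level 0 is the ring, so this is one more than the homological degree in a resolution of
  the ideal.\<close>

definition lq_level :: "nat \<times> 'n set \<Rightarrow> nat" where
  "lq_level = (\<lambda>(q, F). if q = 0 then 0 else Suc (card F))"

definition lq_degree :: "(nat \<Rightarrow> 'n::finite expo) \<Rightarrow> nat \<times> 'n set \<Rightarrow> 'n expo" where
  "lq_degree u = (\<lambda>(q, F). case q of 0 \<Rightarrow> 0 | Suc p \<Rightarrow> u p + sqfree F)"

text \<open>The colon condition on exponents: the monomial of \<open>a\<close> multiplies
  \<open>u p\<close> into the ideal of the earlier generators exactly if a variable of
  \<open>S p\<close> divides it. No field is involved, and \<open>p = 0\<close> forces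
  \<open>S 0\<close> to be empty.\<close>

definition linear_quotient_sets :: "nat \<Rightarrow> (nat \<Rightarrow> 'n expo) \<Rightarrow> (nat \<Rightarrow> 'n set) \<Rightarrow> bool" where
  "linear_quotient_sets m u S \<longleftrightarrow> (\<forall>p<m. \<forall>a. (\<exists>q<p. u q \<preceq> u p + a) \<longleftrightarrow> S p \<inter> keys a \<noteq> {})"

lemma linear_quotients_resolution:
  fixes u :: "nat \<Rightarrow> 'n::finite expo"
  assumes "linear_quotient_sets m u S"
  shows "\<exists>bd :: nat \<times> 'n set \<Rightarrow> nat \<times> 'n set \<Rightarrow>\<^sub>0 'k::field.
    based_resolution lq_level (lq_degree u) (lq_basis m S) bd (0, {}) {a. \<exists>p<m. u p \<preceq> a}"
  using assms
proof (induction m)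
  case 0
  have "lq_basis 0 S = {(0, {})}" by (auto simp: lq_basis_def)
  then show ?case
    by (intro exI[of _ "\<lambda>_. 0"]) (auto simp: based_resolution_def based_complex_def acyclic_on_def)
next
  case (Suc m)
  let ?J = "{a. \<exists>p<m. u p \<preceq> a}" and ?X = "Pair (Suc m) ` {F. {} \<subseteq> F \<and> F \<subseteq> {} \<union> S m}"
  obtain bdY :: "nat \<times> 'n set \<Rightarrow> nat \<times> 'n set \<Rightarrow>\<^sub>0 'k" where
    Y: "based_resolution lq_level (lq_degree u) (lq_basis m S) bdY (0, {}) ?J"
    using Suc by (auto simp: linear_quotient_sets_def)
  obtain bdX :: "nat \<times> 'n set \<Rightarrow> nat \<times> 'n set \<Rightarrow>\<^sub>0 'k" where
    X: "based_resolution lq_level (lq_degree u) ?X bdX (Suc m, {}) {a. \<exists>s\<in>S m. u m + sqfree {s} \<preceq> a}"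
    using koszul_resolution[of lq_level "Pair (Suc m)" 1 "lq_degree u" "u m" "S m" "{}"]
    by (auto simp: lq_level_def lq_degree_def inj_def)
  \<comment> \<open>Multiplying the colon ideal by \<open>u m\<close> gives the intersection of the
    old ideal with that of \<open>u m\<close>.\<close>
  have "(\<exists>s\<in>S m. u m + sqfree {s} \<preceq> a) \<longleftrightarrow> a \<in> ?J \<and> u m \<preceq> a" for a
  proof (cases "u m \<preceq> a")
    case True
    then obtain b where b: "a = u m + b" by (auto simp: mdvd_iff_add)
    have "u m + sqfree {s} \<preceq> a \<longleftrightarrow> s \<in> keys b" for s
      using sqfree_mdvd_iff[of "{s}" b] by (simp add: b mdvd_def lookup_add)
    then show ?thesis
      using Suc.prems True by (auto simp: linear_quotient_sets_def b)
  next
    case False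
    then show ?thesis using mdvd_trans mdvd_add by blast
  qed
  then have JX: "{a. \<exists>s\<in>S m. u m + sqfree {s} \<preceq> a} = ?J \<inter> {a. lq_degree u (Suc m, {}) \<preceq> a}"
    by (auto simp: lq_degree_def sqfree_def)
  have "?X \<inter> lq_basis m S = {}" "lq_level (Suc m, {} :: 'n set) = Suc (lq_level (0, {} :: 'n set))"
    "lq_degree u (0, {}) \<preceq> lq_degree u (Suc m, {})"
    by (auto simp: lq_basis_def lq_level_def lq_degree_def)
  from mapping_cone_resolution[OF X[unfolded JX] Y this]
  obtain bd :: "nat \<times> 'n set \<Rightarrow> nat \<times> 'n set \<Rightarrow>\<^sub>0 'k" where
    "based_resolution lq_level (lq_degree u) (?X \<union> lq_basis m S) bd (0, {})
      (?J \<union> {a. lq_degree u (Suc m, {}) \<preceq> a})"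
    by blast
  moreover have "?X \<union> lq_basis m S = lq_basis (Suc m) S"
    by (auto simp: lq_basis_def less_Suc_eq)
  moreover have "?J \<union> {a. lq_degree u (Suc m, {}) \<preceq> a} = {a. \<exists>p<Suc m. u p \<preceq> a}"
    by (auto simp: lq_degree_def less_Suc_eq sqfree_def)
  ultimately show ?case by auto
qed

lemma linear_quotients_minimal:
  fixes u :: "nat \<Rightarrow> 'n::finite expo" and bd :: "nat \<times> 'n set \<Rightarrow> nat \<times> 'n set \<Rightarrow>\<^sub>0 'k::field"
  assumes "based_complex lq_level (lq_degree u) (lq_basis m S) bd"
    and "\<And>p. p < m \<Longrightarrow> card (keys (u p)) = Suc c" and "\<And>p. p < m \<Longrightarrow> S p \<inter> keys (u p) = {}"
    and "j \<in> lq_basis m S" "i \<in> keys (bd j)"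
  shows "lq_degree u i \<noteq> lq_degree u j"
proof -
  \<comment> \<open>Supports of generators have size \<open>Suc c\<close>, not \<open>c\<close>, so
    that level 1 already has more variables than level 0, which has none; the \<open>Suc\<close> is
    absorbed by the shift between \<open>card F\<close> and the level.\<close>
  have card: "card (keys (lq_degree u b)) = (if lq_level b = 0 then 0 else lq_level b + c)"
    if "b \<in> lq_basis m S" for b
    using that unfolding lq_basis_def
  proof (elim insertE CollectE exE conjE)
    fix p F assume b: "b = (Suc p, F)" "p < m" "F \<subseteq> S p"
    have "keys (u p + sqfree F) = keys (u p) \<union> F"
      by (auto simp: in_keys_iff lookup_add lookup_sqfree)
    moreover have "card (keys (u p) \<union> F) = card (keys (u p)) + card F"
      using assms(3)[OF b(2)] b(3) by (intro card_Un_disjoint) auto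
    ultimately show ?thesis
      using assms(2)[OF b(2)] by (simp add: b(1) lq_degree_def lq_level_def)
  qed (simp add: lq_degree_def lq_level_def)
  have i: "i \<in> lq_basis m S" "Suc (lq_level i) = lq_level j"
    using assms(1,4,5) by (auto simp: based_complex_def)
  have "card (keys (lq_degree u i)) \<noteq> card (keys (lq_degree u j))"
    using i(2) by (auto simp: card[OF i(1)] card[OF assms(4)])
  then show ?thesis by auto
qed

section \<open>Monomial ideals\<close>

lemma single_mult: "single a c * single b d = single (a + b) (c * d :: 'k::field)"
  by (simp add: mult_single)

lemma poly_sum_single: "f = (\<Sum>a\<in>keys f. single a (lookup f a))"
  by (rule poly_mapping_eqI)
    (simp add: lookup_sum lookup_single when_def in_keys_iff)

lemma lookup_single_mult:
  fixes f :: "('n, 'k::field) mpoly"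
  shows "lookup (single b c * f) a = (if b \<preceq> a then c * lookup f (a - b) else 0)"
proof -
  have "single b c * f = (\<Sum>e\<in>keys f. single (b + e) (c * lookup f e))"
    by (subst poly_sum_single[of f]) (simp add: sum_distrib_left single_mult)
  then have *: "lookup (single b c * f) a = (\<Sum>e\<in>keys f. if b + e = a then c * lookup f e else 0)"
    by (simp add: lookup_sum lookup_single when_def)
  show ?thesis
  proof (cases "b \<preceq> a")
    case True
    then have "b + e = a \<longleftrightarrow> a - b = e" for e
      using mdvd_add_diff by (metis add_diff_cancel_left')
    then show ?thesis
      using True by (simp add: * in_keys_iff)
  next
    case False
    then have "b + e \<noteq> a" for e by auto
    then show ?thesis using False by (simp add: *)
  qed
qed

text \<open>Monomial ideals are homogeneous for the finest grading, so membership is decided term by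
  term.\<close>

lemma mem_monomial_ideal_iff:
  fixes f :: "('n, 'k::field) mpoly"
  shows "f \<in> ideal.span (monomial ` U) \<longleftrightarrow> (\<forall>a\<in>keys f. \<exists>u\<in>U. u \<preceq> a)"
proof
  assume "f \<in> ideal.span (monomial ` U)"
  then show "\<forall>a\<in>keys f. \<exists>u\<in>U. u \<preceq> a"
  proof (induction f rule: ideal.span_induct_alt)
    case (step c x y)
    then obtain u where u: "u \<in> U" "x = monomial u" by auto
    have "u \<preceq> a" if "a \<in> keys (c * x)" for a
      using lookup_single_mult[of u 1 c a] that u(2)
      by (auto simp: monomial_def in_keys_iff mult.commute split: if_splits)
    then show ?case
      using step.IH u(1) by (auto dest!: subsetD[OF keys_add])
  qed simp
next
  assume *: "\<forall>a\<in>keys f. \<exists>u\<in>U. u \<preceq> a"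
  have "single a (lookup f a) \<in> ideal.span (monomial ` U)" if a: "a \<in> keys f" for a
  proof -
    obtain u where u: "u \<in> U" "u \<preceq> a" using * a by blast
    have "single a (lookup f a) = single (a - u) (lookup f a) * monomial u"
      using mdvd_add_diff[OF u(2)] by (simp add: monomial_def single_mult add.commute)
    then show ?thesis using u(1) by (metis ideal.span_base ideal.span_scale imageI)
  qed
  then show "f \<in> ideal.span (monomial ` U)"
    by (subst poly_sum_single[of f]) (rule ideal.span_sum)
qed

lemma monomial_mem_iff:
  "(monomial a :: ('n, 'k::field) mpoly) \<in> ideal.span (monomial ` U) \<longleftrightarrow> (\<exists>u\<in>U. u \<preceq> a)"
  by (simp add: mem_monomial_ideal_iff) (simp add: monomial_def)

lemma mem_ideal_vars_iff:
  fixes f :: "('n, 'k::field) mpoly"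
  shows "f \<in> ideal.span (var ` V) \<longleftrightarrow> (\<forall>a\<in>keys f. V \<inter> keys a \<noteq> {})"
proof -
  have 1: "single i 1 \<preceq> a \<longleftrightarrow> i \<in> keys a" for i and a :: "'n expo"
    by (auto simp: mdvd_def lookup_single when_def in_keys_iff Suc_le_eq)
  have "var ` V = (monomial ` ((\<lambda>i. single i 1) ` V) :: ('n, 'k) mpoly set)"
    by (simp add: image_image var_def)
  then have "f \<in> ideal.span (var ` V) \<longleftrightarrow> (\<forall>a\<in>keys f. \<exists>i\<in>V. single i 1 \<preceq> a)"
    by (simp only: mem_monomial_ideal_iff bex_simps)
  then show ?thesis unfolding 1 by blast
qed

section \<open>Homogeneous components of complexes of free modules\<close>

text \<open>
  The basis in homological degree \<open>k\<close> is enumerated by \<open>L k\<close>. Degree \<open>0\<close> is that of \<open>R\<close> itself, so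
  degree \<open>Suc k\<close> corresponds to the \<open>k\<close>th module of a resolution of the ideal.
\<close>

locale graded_basis =
  fixes h :: "'b \<Rightarrow> nat" and \<delta> :: "'b \<Rightarrow> 'n expo" and B :: "'b set"
    and bd :: "'b \<Rightarrow> 'b \<Rightarrow>\<^sub>0 'k::field" and L :: "nat \<Rightarrow> 'b list"
  assumes keys_bd: "\<And>j i. j \<in> B \<Longrightarrow> i \<in> keys (bd j) \<Longrightarrow> i \<in> B \<and> Suc (h i) = h j \<and> \<delta> i \<preceq> \<delta> j"
    and distinct_L: "\<And>k. distinct (L k)" and set_L: "\<And>k. set (L k) = {j \<in> B. h j = k}"
begin

text \<open>The scalar entry is given the monomial that makes the map homogeneous of degree zero.
  The truncated subtraction is harmless: without divisibility the coefficient is 0, see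
  \<open>lookup_bd_eq_0\<close>.\<close>

definition mat :: "nat \<Rightarrow> nat \<Rightarrow> nat \<Rightarrow> ('n, 'k) mpoly" where
  "mat k i j = single (\<delta> (L (Suc k) ! j) - \<delta> (L k ! i)) (lookup (bd (L (Suc k) ! j)) (L k ! i))"

definition D :: "nat \<Rightarrow> (nat \<Rightarrow> ('n, 'k) mpoly) \<Rightarrow> nat \<Rightarrow> ('n, 'k) mpoly" where
  "D k = mat_map (length (L k)) (length (L (Suc k))) (mat k)"

text \<open>Puts back the monomials that a strand suppresses, giving a homogeneous vector of degree
  \<open>a\<close>; \<open>hcomp\<close> is the reverse passage, defined on all vectors.\<close>

definition emb :: "nat \<Rightarrow> 'n expo \<Rightarrow> ('b \<Rightarrow>\<^sub>0 'k) \<Rightarrow> nat \<Rightarrow> ('n, 'k) mpoly" where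
  "emb k a x = (\<lambda>j. if j < length (L k) \<and> \<delta> (L k ! j) \<preceq> a
     then single (a - \<delta> (L k ! j)) (lookup x (L k ! j)) else 0)"

definition hcomp :: "nat \<Rightarrow> 'n expo \<Rightarrow> (nat \<Rightarrow> ('n, 'k) mpoly) \<Rightarrow> 'b \<Rightarrow>\<^sub>0 'k" where
  "hcomp k a v = (\<Sum>j<length (L k). if \<delta> (L k ! j) \<preceq> a
     then single (L k ! j) (lookup (v j) (a - \<delta> (L k ! j))) else 0)"

lemma L_in: "j < length (L k) \<Longrightarrow> L k ! j \<in> B \<and> h (L k ! j) = k"
  using set_L[of k] nth_mem by blast

lemma in_L: "b \<in> B \<Longrightarrow> h b = k \<Longrightarrow> \<exists>j<length (L k). L k ! j = b"
  using set_L[of k] by (metis (mono_tags, lifting) in_set_conv_nth mem_Collect_eq)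

lemma L_eq: "i < length (L k) \<Longrightarrow> j < length (L k) \<Longrightarrow> L k ! i = L k ! j \<longleftrightarrow> i = j"
  by (rule nth_eq_iff_index_eq[OF distinct_L])

lemma sum_L: "(\<Sum>j<length (L k). f (L k ! j)) = sum f {b \<in> B. h b = k}"
proof -
  have "bij_betw ((!) (L k)) {..<length (L k)} (set (L k))"
    by (rule bij_betw_nth[OF distinct_L refl refl])
  then show ?thesis
    unfolding set_L by (rule sum.reindex_bij_betw)
qed

lemma finite_level: "finite {b \<in> B. h b = k}"
  using set_L[of k] finite_set by metis

lemma lookup_lin_strand:
  assumes "x \<in> strand h \<delta> B k a"
  shows "lookup (lin f x) i = (\<Sum>j<length (L k). lookup x (L k ! j) * lookup (f (L k ! j)) i)"
  unfolding sum_L[of "\<lambda>b. lookup x b * lookup (f b) i"]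
  by (rule lookup_lin_superset[OF finite_level]) (use assms in \<open>auto simp: strand_def\<close>)

lemma strand_eqI:
  assumes "x \<in> strand h \<delta> B k a" "y \<in> strand h \<delta> B k a"
    and "\<And>j. j < length (L k) \<Longrightarrow> lookup x (L k ! j) = lookup y (L k ! j)"
  shows "x = y"
proof (rule poly_mapping_eqI)
  fix b
  show "lookup x b = lookup y b"
  proof (cases "b \<in> B \<and> h b = k")
    case True
    then show ?thesis using assms(3) in_L by metis
  next
    case False
    then have "b \<notin> keys x" "b \<notin> keys y"
      using assms(1,2) by (auto simp: strand_def)
    then show ?thesis by (simp add: in_keys_iff)
  qed
qed

lemma lookup_hcomp:
  assumes "i < length (L k)"
  shows "lookup (hcomp k a v) (L k ! i)
    = (if \<delta> (L k ! i) \<preceq> a then lookup (v i) (a - \<delta> (L k ! i)) else 0)"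
proof -
  have "lookup (hcomp k a v) (L k ! i) = (\<Sum>j<length (L k). if j = i then
      (if \<delta> (L k ! i) \<preceq> a then lookup (v i) (a - \<delta> (L k ! i)) else 0) else 0)"
    unfolding hcomp_def lookup_sum
    by (rule sum.cong) (use assms L_eq in \<open>auto simp: lookup_single when_def\<close>)
  then show ?thesis using assms by simp
qed

lemma hcomp_strand: "hcomp k a v \<in> strand h \<delta> B k a"
proof -
  have "\<exists>j<length (L k). \<delta> (L k ! j) \<preceq> a \<and> b = L k ! j" if b: "b \<in> keys (hcomp k a v)" for b
  proof (rule ccontr)
    assume *: "\<not> ?thesis"
    have "lookup (hcomp k a v) b = 0"
      unfolding hcomp_def lookup_sum
      by (rule sum.neutral) (use * in \<open>auto simp: lookup_single when_def\<close>)
    then show False using b by (simp add: in_keys_iff)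
  qed
  then show ?thesis
    unfolding strand_def using L_in by blast
qed

lemma bd_strand: "x \<in> strand h \<delta> B (Suc k) a \<Longrightarrow> lin bd x \<in> strand h \<delta> B k a"
proof (intro strand_lin)
  fix j assume "x \<in> strand h \<delta> B (Suc k) a" "j \<in> keys x"
  then have j: "j \<in> B" "h j = Suc k" "\<delta> j \<preceq> a" by (auto dest: strandD)
  show "bd j \<in> strand h \<delta> B k a"
    unfolding strand_def using keys_bd[OF j(1)] j(2,3) mdvd_trans by fastforce
qed

lemma hcomp_emb: "x \<in> strand h \<delta> B k a \<Longrightarrow> hcomp k a (emb k a x) = x"
  by (rule strand_eqI[OF hcomp_strand])
    (auto simp: lookup_hcomp emb_def dest: strandD simp flip: not_in_keys_iff_lookup_eq_zero)

lemma lookup_bd_eq_0: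
  assumes "i < length (L k)" "j < length (L (Suc k))" "\<not> \<delta> (L k ! i) \<preceq> \<delta> (L (Suc k) ! j)"
  shows "lookup (bd (L (Suc k) ! j)) (L k ! i) = 0"
  using keys_bd[of "L (Suc k) ! j" "L k ! i"] L_in[OF assms(2)] assms(3) by (auto simp: in_keys_iff)

lemma diff_diff_mdvd: "a \<preceq> b \<Longrightarrow> b \<preceq> c \<Longrightarrow> (c - b) + (b - a) = c - (a :: 'n expo)"
  by (rule poly_mapping_eqI) (simp add: mdvd_def lookup_add lookup_minus)

text \<open>Along each path from \<open>j\<close> to \<open>i\<close> the monomials multiply to that
  of \<open>a - \<delta> i\<close>, independently of \<open>j\<close>, so only the scalars are
  summed.\<close>

lemma D_emb:
  assumes x: "x \<in> strand h \<delta> B (Suc k) a"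
  shows "D k (emb (Suc k) a x) = emb k a (lin bd x)"
proof
  fix i
  show "D k (emb (Suc k) a x) i = emb k a (lin bd x) i"
  proof (cases "i < length (L k)")
    case i: True
    let ?b = "\<lambda>j. L (Suc k) ! j"
    have x0: "lookup x (?b j) = 0" if "\<not> \<delta> (?b j) \<preceq> a" for j
      using strandD[OF x] that by (metis in_keys_iff)
    have t: "mat k i j * emb (Suc k) a x j = (if \<delta> (L k ! i) \<preceq> a then
        single (a - \<delta> (L k ! i)) (lookup x (?b j) * lookup (bd (?b j)) (L k ! i)) else 0)"
      if j: "j < length (L (Suc k))" for j
    proof (cases "\<delta> (L k ! i) \<preceq> \<delta> (?b j) \<and> \<delta> (?b j) \<preceq> a")
      case True
      then show ?thesis
        using j mdvd_trans by (auto simp: mat_def emb_def single_mult diff_diff_mdvd mult.commute add.commute)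
    next
      case False
      then show ?thesis
        using j x0 lookup_bd_eq_0[OF i j] by (auto simp: mat_def emb_def)
    qed
    have "D k (emb (Suc k) a x) i = (\<Sum>j<length (L (Suc k)). if \<delta> (L k ! i) \<preceq> a then
        single (a - \<delta> (L k ! i)) (lookup x (?b j) * lookup (bd (?b j)) (L k ! i)) else 0)"
      using i t by (simp add: D_def mat_map_def)
    also have "\<dots> = emb k a (lin bd x) i"
      using i unfolding emb_def lookup_lin_strand[OF x]
      by (intro poly_mapping_eqI) (simp add: lookup_sum lookup_single when_def)
    finally show ?thesis .
  qed (simp add: D_def mat_map_def emb_def)
qed

lemma hcomp_D: "hcomp k a (D k v) = lin bd (hcomp (Suc k) a v)"
proof (rule strand_eqI[OF hcomp_strand bd_strand[OF hcomp_strand]])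
  fix i assume i: "i < length (L k)"
  let ?b = "\<lambda>j. L (Suc k) ! j"
  have "lookup (mat k i j * v j) (a - \<delta> (L k ! i)) =
      (if \<delta> (?b j) \<preceq> a then lookup (v j) (a - \<delta> (?b j)) else 0) * lookup (bd (?b j)) (L k ! i)"
    if j: "j < length (L (Suc k))" and ia: "\<delta> (L k ! i) \<preceq> a" for j
  proof (cases "\<delta> (L k ! i) \<preceq> \<delta> (?b j)")
    case True
    have "\<delta> (?b j) - \<delta> (L k ! i) \<preceq> a - \<delta> (L k ! i) \<longleftrightarrow> \<delta> (?b j) \<preceq> a"
    proof -
      have "lookup (\<delta> (?b j)) n - lookup (\<delta> (L k ! i)) n \<le> lookup a n - lookup (\<delta> (L k ! i)) n
          \<longleftrightarrow> lookup (\<delta> (?b j)) n \<le> lookup a n" for n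
        using True ia unfolding mdvd_def by (metis diff_le_mono eq_diff_iff le_diff_iff)
      then show ?thesis by (simp add: mdvd_def lookup_minus)
    qed
    moreover have "a - \<delta> (L k ! i) - (\<delta> (?b j) - \<delta> (L k ! i)) = a - \<delta> (?b j)"
      using mdvd_add_diff[OF True] by (simp add: diff_diff_add)
    ultimately show ?thesis
      unfolding mat_def lookup_single_mult by (simp add: mult.commute)
  next
    case False
    then show ?thesis
      using lookup_bd_eq_0[OF i j] by (simp add: mat_def)
  qed
  moreover have "(if \<delta> (?b j) \<preceq> a then lookup (v j) (a - \<delta> (?b j)) else 0) * lookup (bd (?b j)) (L k ! i) = 0"
    if "j < length (L (Suc k))" "\<not> \<delta> (L k ! i) \<preceq> a" for j
    using lookup_bd_eq_0[OF i that(1)] that mdvd_trans by auto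
  ultimately show "lookup (hcomp k a (D k v)) (L k ! i) = lookup (lin bd (hcomp (Suc k) a v)) (L k ! i)"
    using i by (auto simp: lookup_hcomp lookup_lin_strand[OF hcomp_strand] D_def mat_map_def lookup_sum
        intro!: sum.neutral)
qed

text \<open>Finitely many multidegrees suffice to recover \<open>v\<close> from its
  components.\<close>

definition degs :: "nat \<Rightarrow> (nat \<Rightarrow> ('n, 'k) mpoly) \<Rightarrow> 'n expo set" where
  "degs k v = (\<Union>j<length (L k). (\<lambda>c. \<delta> (L k ! j) + c) ` keys (v j))"

lemma finite_degs: "finite (degs k v)"
  by (simp add: degs_def)

lemma decomposition:
  assumes v: "v \<in> free_module (length (L k))"
  shows "v = (\<lambda>j. \<Sum>a\<in>degs k v. emb k a (hcomp k a v) j)"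
proof
  fix j
  show "v j = (\<Sum>a\<in>degs k v. emb k a (hcomp k a v) j)"
  proof (cases "j < length (L k)")
    case j: True
    show ?thesis
    proof (rule poly_mapping_eqI)
      fix c
      let ?d = "\<delta> (L k ! j)"
      have "lookup (emb k a (hcomp k a v) j) c = (if a = ?d + c then lookup (v j) c else 0)" for a
      proof (cases "?d \<preceq> a")
        case True
        then have "a = ?d + c \<longleftrightarrow> a - ?d = c"
          using mdvd_add_diff by (metis add_diff_cancel_left')
        then show ?thesis
          using True j by (auto simp: emb_def lookup_hcomp lookup_single when_def)
      qed (auto simp: emb_def)
      then have "lookup (\<Sum>a\<in>degs k v. emb k a (hcomp k a v) j) c
          = (if ?d + c \<in> degs k v then lookup (v j) c else 0)"
        by (simp add: lookup_sum finite_degs)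
      moreover have "?d + c \<in> degs k v" if "c \<in> keys (v j)"
        using that j by (auto simp: degs_def)
      ultimately show "lookup (v j) c = lookup (\<Sum>a\<in>degs k v. emb k a (hcomp k a v) j) c"
        by (auto simp: in_keys_iff)
    qed
  qed (use v in \<open>simp add: free_module_def emb_def\<close>)
qed

lemma emb_zero [simp]: "emb k a 0 = (\<lambda>_. 0)"
  by (auto simp: emb_def)

lemma hcomp_zero [simp]: "hcomp k a (\<lambda>_. 0) = 0"
  by (auto simp: hcomp_def intro!: sum.neutral)

lemma emb_free: "emb k a x \<in> free_module (length (L k))"
  by (simp add: free_module_def emb_def)

lemma D_free: "D k v \<in> free_module (length (L k))"
  by (simp add: free_module_def D_def mat_map_def)

lemma zero_if_hcomp_zero:
  assumes "v \<in> free_module (length (L k))" "\<And>a. hcomp k a v = 0"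
  shows "v = (\<lambda>_. 0)"
  using decomposition[OF assms(1)] by (simp add: assms(2))

lemma D_sum: "D k (\<lambda>j. \<Sum>a\<in>A. f a j) = (\<lambda>i. \<Sum>a\<in>A. D k (f a) i)"
proof
  fix i
  show "D k (\<lambda>j. \<Sum>a\<in>A. f a j) i = (\<Sum>a\<in>A. D k (f a) i)"
    by (simp add: D_def mat_map_def sum_distrib_left sum.swap[of _ A])
qed

text \<open>Preimages can be chosen degree by degree; only those for degrees in
  \<open>degs k v\<close> enter the sum, which is therefore finite.\<close>

lemma image_D_iff:
  assumes v: "v \<in> free_module (length (L k))"
  shows "v \<in> D k ` free_module (length (L (Suc k)))
    \<longleftrightarrow> (\<forall>a. \<exists>y\<in>strand h \<delta> B (Suc k) a. lin bd y = hcomp k a v)"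
proof
  assume "v \<in> D k ` free_module (length (L (Suc k)))"
  then show "\<forall>a. \<exists>y\<in>strand h \<delta> B (Suc k) a. lin bd y = hcomp k a v"
    using hcomp_D hcomp_strand by fastforce
next
  assume "\<forall>a. \<exists>y\<in>strand h \<delta> B (Suc k) a. lin bd y = hcomp k a v"
  then obtain y where y: "\<And>a. y a \<in> strand h \<delta> B (Suc k) a" "\<And>a. lin bd (y a) = hcomp k a v"
    by metis
  have "D k (\<lambda>j. \<Sum>a\<in>degs k v. emb (Suc k) a (y a) j) = v"
    unfolding D_sum D_emb[OF y(1)] y(2) by (rule decomposition[OF v, symmetric])
  moreover have "(\<lambda>j. \<Sum>a\<in>degs k v. emb (Suc k) a (y a) j) \<in> free_module (length (L (Suc k)))"
    using emb_free by (simp add: free_module_def)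
  ultimately show "v \<in> D k ` free_module (length (L (Suc k)))"
    by (rule image_eqI[OF sym])
qed

lemma kernel_D_iff:
  assumes v: "v \<in> free_module (length (L (Suc k)))"
  shows "D k v = (\<lambda>_. 0) \<longleftrightarrow> (\<forall>a. lin bd (hcomp (Suc k) a v) = 0)"
  using zero_if_hcomp_zero[OF D_free] by (auto simp: hcomp_D[symmetric])

text \<open>Used in one direction to turn the cone into a resolution by free modules, in the other
  to read strands off a given resolution.\<close>

lemma exact_iff:
  "{v \<in> free_module (length (L (Suc k))). D k v = (\<lambda>_. 0)} = D (Suc k) ` free_module (length (L (Suc (Suc k))))
   \<longleftrightarrow> (\<forall>a. {x \<in> strand h \<delta> B (Suc k) a. lin bd x = 0} = lin bd ` strand h \<delta> B (Suc (Suc k)) a)"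
  (is "?P \<longleftrightarrow> ?S")
proof
  assume P: ?P
  show ?S
  proof (intro allI set_eqI iffI)
    fix a x assume "x \<in> {x \<in> strand h \<delta> B (Suc k) a. lin bd x = 0}"
    then have x: "x \<in> strand h \<delta> B (Suc k) a" "lin bd x = 0" by auto
    have "D k (emb (Suc k) a x) = (\<lambda>_. 0)"
      by (simp add: D_emb[OF x(1)] x(2))
    then have "emb (Suc k) a x \<in> D (Suc k) ` free_module (length (L (Suc (Suc k))))"
      using P emb_free by blast
    then obtain y where "y \<in> strand h \<delta> B (Suc (Suc k)) a" "lin bd y = hcomp (Suc k) a (emb (Suc k) a x)"
      unfolding image_D_iff[OF emb_free] by blast
    then show "x \<in> lin bd ` strand h \<delta> B (Suc (Suc k)) a"
      unfolding hcomp_emb[OF x(1)] by blast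
  next
    fix a x assume "x \<in> lin bd ` strand h \<delta> B (Suc (Suc k)) a"
    then obtain y where y: "y \<in> strand h \<delta> B (Suc (Suc k)) a" "x = lin bd y" by blast
    have "D (Suc k) (emb (Suc (Suc k)) a y) \<in> {v \<in> free_module (length (L (Suc k))). D k v = (\<lambda>_. 0)}"
      using P emb_free by blast
    then have "lin bd (hcomp (Suc k) a (D (Suc k) (emb (Suc (Suc k)) a y))) = 0"
      using kernel_D_iff by blast
    then show "x \<in> {x \<in> strand h \<delta> B (Suc k) a. lin bd x = 0}"
      using y bd_strand by (simp add: hcomp_D hcomp_emb)
  qed
next
  assume S: ?S
  have "D k v = (\<lambda>_. 0) \<longleftrightarrow> v \<in> D (Suc k) ` free_module (length (L (Suc (Suc k))))"
    if v: "v \<in> free_module (length (L (Suc k)))" for v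
  proof -
    have "lin bd (hcomp (Suc k) a v) = 0 \<longleftrightarrow> (\<exists>y\<in>strand h \<delta> B (Suc (Suc k)) a. lin bd y = hcomp (Suc k) a v)" for a
    proof -
      have "lin bd (hcomp (Suc k) a v) = 0 \<longleftrightarrow> hcomp (Suc k) a v \<in> {x \<in> strand h \<delta> B (Suc k) a. lin bd x = 0}"
        by (simp add: hcomp_strand)
      also have "\<dots> \<longleftrightarrow> hcomp (Suc k) a v \<in> lin bd ` strand h \<delta> B (Suc (Suc k)) a"
        using S by simp
      finally show ?thesis unfolding image_iff by metis
    qed
    then show ?thesis
      unfolding kernel_D_iff[OF v] image_D_iff[OF v] by blast
  qed
  then show ?P
    using D_free by blast
qed

end

section \<open>Passage between matrix resolutions and based resolutions\<close>

lemma (in graded_basis) degree_zero_map_mat: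
  assumes "i < length (L k)" "j < length (L (Suc k))"
  shows "degree_zero_map (\<delta> (L (Suc k) ! j)) (\<delta> (L k ! i)) (mat k i j)"
  using lookup_bd_eq_0[OF assms] by (auto simp: degree_zero_map_def mat_def intro: mdvd_add_diff)

text \<open>\<open>graded_free_resolution\<close> treats the augmentation as a row with values in
  the ring; here the ring becomes the free module of rank one in level 0.\<close>

lemma augmentation:
  assumes "r = 1"
  shows "mat_map r n M v = (\<lambda>_. 0) \<longleftrightarrow> (\<Sum>j<n. M 0 j * v j) = (0 :: ('n, 'k::field) mpoly)"
    and "(\<lambda>v. \<Sum>j<n. M 0 j * v j) ` V = {f. (\<lambda>i. if i = 0 then f else 0) \<in> mat_map r n M ` V}"
proof -
  have D: "mat_map r n M = (\<lambda>v i. if i = 0 then \<Sum>j<n. M 0 j * v j else 0)"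
    using assms by (auto simp: mat_map_def fun_eq_iff)
  have vec: "(\<lambda>i :: nat. if i = 0 then f else 0) = (\<lambda>i. if i = 0 then g else 0) \<longleftrightarrow> f = g"
    for f g :: "('n, 'k) mpoly"
    by (metis (full_types))
  show "mat_map r n M v = (\<lambda>_. 0) \<longleftrightarrow> (\<Sum>j<n. M 0 j * v j) = 0"
    unfolding D using vec[of _ 0] by simp
  show "(\<lambda>v. \<Sum>j<n. M 0 j * v j) ` V = {f. (\<lambda>i. if i = 0 then f else 0) \<in> mat_map r n M ` V}"
    unfolding D image_iff vec by auto
qed

text \<open>Guarantees that the choice in \<open>betti\<close> really yields a minimal
  resolution.\<close>

lemma minimal_resolution_exists:
  fixes \<delta> :: "'b \<Rightarrow> 'n expo" and bd :: "'b \<Rightarrow> 'b \<Rightarrow>\<^sub>0 'k::field"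
  assumes R: "based_resolution h \<delta> B bd z {a. \<exists>u\<in>U. u \<preceq> a}" and z: "h z = 0" "\<delta> z = 0"
    and fin: "\<And>k. finite {j \<in> B. h j = k}"
    and min: "\<And>j i. j \<in> B \<Longrightarrow> i \<in> keys (bd j) \<Longrightarrow> \<delta> i \<noteq> \<delta> j"
  shows "\<exists>F d e. minimal_graded_free_resolution (ideal.span (monomial ` U) :: ('n, 'k) mpoly set) F d e"
proof -
  note cR = based_resolutionD(1)[OF R] and aR = based_resolutionD(2)[OF R]
    and zB = based_resolutionD(3)[OF R] and dR = based_resolutionD(4,5)[OF R]
  have "\<forall>k. \<exists>xs. set xs = {j \<in> B. h j = k} \<and> distinct xs"
    using finite_distinct_list[OF fin] by blast
  then obtain L where L: "\<And>k. set (L k) = {j \<in> B. h j = k} \<and> distinct (L k)"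
    by metis
  interpret graded_basis h \<delta> B bd L
    by standard (use cR L in \<open>auto simp: based_complex_def\<close>)
  have "set (L 0) = {z}"
    using L dR(2) zB z by force
  then have L0: "L 0 = [z]"
    using L[of 0] by (cases "L 0"; cases "tl (L 0)") auto
  have J: "\<exists>u\<in>U. u \<preceq> a" if "x \<in> strand h \<delta> B (Suc k) a" "x \<noteq> 0" for x k a
  proof -
    obtain j where "j \<in> keys x" using \<open>x \<noteq> 0\<close> by (metis all_not_in_conv keys_eq_empty)
    then have j: "j \<in> B" "h j = Suc k" "\<delta> j \<preceq> a" using strandD[OF that(1)] by auto
    then show ?thesis using dR(1)[OF j(1)] z mdvd_trans by fastforce
  qed
  have bd0: "lin bd x = 0" if "x \<in> strand h \<delta> B 0 a" for x a
  proof (rule lin_eq_0)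
    fix j assume "j \<in> keys x"
    then have "j = z" using strandD[OF that] dR(2) z by fastforce
    then show "bd j = 0" using resolution_least[OF R] by simp
  qed
  have exact: "{x \<in> strand h \<delta> B (Suc k) a. lin bd x = 0} = lin bd ` strand h \<delta> B (Suc (Suc k)) a" for k a
  proof (intro set_eqI iffI)
    fix x assume x: "x \<in> {x \<in> strand h \<delta> B (Suc k) a. lin bd x = 0}"
    show "x \<in> lin bd ` strand h \<delta> B (Suc (Suc k)) a"
    proof (cases "x = 0")
      case False
      then show ?thesis
        using x J aR unfolding acyclic_on_def by blast
    qed (auto intro!: image_eqI[of _ _ 0])
  next
    fix x assume "x \<in> lin bd ` strand h \<delta> B (Suc (Suc k)) a"
    then show "x \<in> {x \<in> strand h \<delta> B (Suc k) a. lin bd x = 0}"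
      using lin_boundary_boundary[OF cR] bd_strand by auto
  qed
  define vec :: "('n, 'k) mpoly \<Rightarrow> nat \<Rightarrow> ('n, 'k) mpoly" where "vec f = (\<lambda>i. if i = 0 then f else 0)" for f
  have vec: "vec f \<in> D 0 ` free_module (length (L (Suc 0))) \<longleftrightarrow> f \<in> ideal.span (monomial ` U)" for f
  proof -
    have v: "vec f \<in> free_module (length (L 0))"
      by (simp add: vec_def free_module_def L0)
    have c: "lookup (hcomp 0 a (vec f)) z = lookup f a" for a
      using lookup_hcomp[of 0 0 a "vec f"] by (simp add: L0 z vec_def)
    \<comment> \<open>The strand in level 0 is spanned by \<open>z\<close>. If \<open>a\<close> is
      an exponent of the ideal, all of it bounds; otherwise level 1 is zero and the coefficient of
      \<open>f\<close> has to vanish.\<close>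
    have "(\<exists>y\<in>strand h \<delta> B (Suc 0) a. lin bd y = hcomp 0 a (vec f)) \<longleftrightarrow> (a \<in> keys f \<longrightarrow> (\<exists>u\<in>U. u \<preceq> a))" for a
    proof (cases "\<exists>u\<in>U. u \<preceq> a")
      case True
      then show ?thesis
        using aR hcomp_strand[of 0 a "vec f"] bd0[OF hcomp_strand] unfolding acyclic_on_def by blast
    next
      case False
      then have y0: "y = 0" if "y \<in> strand h \<delta> B (Suc 0) a" for y
        using J that by blast
      have "hcomp 0 a (vec f) = 0 \<longleftrightarrow> lookup f a = 0"
      proof
        show "hcomp 0 a (vec f) = 0" if "lookup f a = 0"
          by (rule strand_eqI[OF hcomp_strand]) (use that c in \<open>auto simp: L0\<close>)
      qed (use c[of a] in simp)
      then show ?thesis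
        using False y0 by (metis in_keys_iff lin_zero strand_zero)
    qed
    then show ?thesis
      unfolding image_D_iff[OF v] mem_monomial_ideal_iff by blast
  qed
  define F where "F k = map \<delta> (L (Suc k))" for k
  define d where "d k = mat (Suc k)" for k
  define e where "e = mat 0 0"
  have len: "length (F k) = length (L (Suc k))" for k
    by (simp add: F_def)
  have Dd: "mat_map (length (F k)) (length (F (Suc k))) (d k) = D (Suc k)" for k
    by (simp add: len d_def D_def)
  have D0: "D 0 = mat_map (length (L 0)) (length (L (Suc 0))) (mat 0)"
    by (simp add: D_def)
  have "length (L 0) = 1" by (simp add: L0)
  note aug = augmentation[OF this, where n = "length (L (Suc 0))" and M = "mat 0", folded D0 e_def]
  have "graded_free_resolution (ideal.span (monomial ` U)) F d e"
    unfolding graded_free_resolution_def Let_def len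
    unfolding Dd[unfolded len]
  proof (intro conjI allI impI)
    show "degree_zero_map (F 0 ! j) 0 (e j)" if "j < length (L (Suc 0))" for j
      using degree_zero_map_mat[of 0 0 j] that by (simp add: F_def e_def L0 z)
    show "degree_zero_map (F (Suc k) ! j) (F k ! i) (d k i j)"
      if "i < length (L (Suc k))" "j < length (L (Suc (Suc k)))" for k i j
      using degree_zero_map_mat[of i "Suc k" j] that by (simp add: F_def d_def)
    show "(\<lambda>v. \<Sum>j<length (L (Suc 0)). e j * v j) ` free_module (length (L (Suc 0)))
        = ideal.span (monomial ` U)"
      unfolding aug(2) using vec by (auto simp: vec_def)
    show "{v \<in> free_module (length (L (Suc 0))). (\<Sum>j<length (L (Suc 0)). e j * v j) = 0}
        = D (Suc 0) ` free_module (length (L (Suc 1)))"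
      unfolding aug(1)[symmetric] One_nat_def exact_iff using exact by blast
    show "{v \<in> free_module (length (L (Suc (Suc k)))). D (Suc k) v = (\<lambda>_. 0)}
        = D (Suc (Suc k)) ` free_module (length (L (Suc (Suc (Suc k)))))" for k
      unfolding exact_iff using exact by blast
  qed
  moreover have "d k i j \<in> ideal.span (range var)"
    if ij: "i < length (F k)" "j < length (F (Suc k))" for k i j
  proof (cases "L (Suc k) ! i \<in> keys (bd (L (Suc (Suc k)) ! j))")
    case True
    let ?a = "\<delta> (L (Suc (Suc k)) ! j)" and ?b = "\<delta> (L (Suc k) ! i)"
    have "L (Suc (Suc k)) ! j \<in> B" using L_in ij by (simp add: len)
    then have "?b \<preceq> ?a" "?b \<noteq> ?a" using keys_bd min True by auto
    then have "?a - ?b \<noteq> 0" using mdvd_add_diff by force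
    then have "keys (?a - ?b) \<noteq> {}" by simp
    then show ?thesis
      by (auto simp: mem_ideal_vars_iff d_def mat_def)
  next
    case False
    then show ?thesis by (simp add: d_def mat_def in_keys_iff ideal.span_zero)
  qed
  ultimately show ?thesis
    unfolding minimal_graded_free_resolution_def by blast
qed

text \<open>Brings the resolution chosen in \<open>betti\<close> into the language of strands. The
  ring is put in front as level 0, hence the rank 1 and the degree 0; \<open>(k, j)\<close> labels
  basis element \<open>j\<close> of level \<open>k\<close>.\<close>

lemma based_resolution_of_minimal_resolution:
  fixes d :: "nat \<Rightarrow> nat \<Rightarrow> nat \<Rightarrow> ('n, 'k::field) mpoly"
  assumes M: "minimal_graded_free_resolution (ideal.span (monomial ` U)) F d e" and "0 \<notin> U"
  defines "r \<equiv> case_nat 1 (\<lambda>k. length (F k))"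
    and "\<delta> \<equiv> \<lambda>(k, j). case k of 0 \<Rightarrow> 0 | Suc k \<Rightarrow> F k ! j"
  shows "\<exists>bd :: nat \<times> nat \<Rightarrow> nat \<times> nat \<Rightarrow>\<^sub>0 'k.
    based_resolution fst \<delta> {(k, j). j < r k} bd (0, 0) {a. \<exists>u\<in>U. u \<preceq> a} \<and>
    (\<forall>j\<in>{(k, j). j < r k}. \<forall>i\<in>keys (bd j). \<delta> i \<noteq> \<delta> j)"
proof -
  let ?J = "{a. \<exists>u\<in>U. u \<preceq> a}"
  define B where "B = {(k, j). j < r k}"
  define m :: "nat \<Rightarrow> nat \<Rightarrow> nat \<Rightarrow> ('n, 'k) mpoly" where "m = case_nat (\<lambda>i. e) d"
  \<comment> \<open>A matrix entry is a multiple of one monomial, and \<open>bd\<close> keeps its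
    coefficient. If the degrees do not divide, the entry is 0, so reading it at a truncated
    difference does no harm.\<close>
  define bd where "bd = (\<lambda>(k, j). case k of 0 \<Rightarrow> 0 | Suc k \<Rightarrow>
      (\<Sum>i<r k. single (k, i) (lookup (m k i j) (\<delta> (Suc k, j) - \<delta> (k, i)))))"
  have r: "r 0 = 1" "\<And>k. r (Suc k) = length (F k)"
    and m: "m 0 = (\<lambda>i. e)" "\<And>k. m (Suc k) = d k"
    and \<delta>: "\<And>j. \<delta> (0, j) = 0" "\<And>k j. \<delta> (Suc k, j) = F k ! j"
    by (simp_all add: r_def m_def \<delta>_def)
  have G: "graded_free_resolution (ideal.span (monomial ` U)) F d e"
    and dmin: "\<And>k i j. i < length (F k) \<Longrightarrow> j < length (F (Suc k)) \<Longrightarrow> d k i j \<in> ideal.span (range var)"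
    using M by (auto simp: minimal_graded_free_resolution_def)
  have dz: "degree_zero_map (\<delta> (Suc k, j)) (\<delta> (k, i)) (m k i j)" if "i < r k" "j < r (Suc k)" for k i j
    using G that by (cases k) (auto simp: graded_free_resolution_def Let_def r m \<delta>)
  have lookup_bd: "lookup (bd (Suc k, j)) b =
      (if fst b = k \<and> snd b < r k then lookup (m k (snd b) j) (\<delta> (Suc k, j) - \<delta> b) else 0)" for k j b
    by (cases b) (auto simp: bd_def lookup_sum lookup_single when_def)
  define L where "L k = map (Pair k) [0..<r k]" for k
  have lenL: "length (L k) = r k" and L: "\<And>j. j < r k \<Longrightarrow> L k ! j = (k, j)" for k
    by (simp_all add: L_def)
  interpret graded_basis fst \<delta> B bd L
  proof
    fix b i assume b: "b \<in> B" and i: "i \<in> keys (bd b)"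
    obtain k j where kj: "b = (Suc k, j)"
      using i by (cases b; cases "fst b") (auto simp: bd_def)
    have ik: "fst i = k" "snd i < r k" and
      l: "\<delta> (Suc k, j) - \<delta> i \<in> keys (m k (snd i) j)"
      using i unfolding in_keys_iff kj lookup_bd by (auto split: if_splits)
    have "\<delta> i + (\<delta> (Suc k, j) - \<delta> i) = \<delta> (Suc k, j)"
      using dz[of "snd i" k j] ik l b unfolding kj by (cases i) (auto simp: degree_zero_map_def B_def)
    then show "i \<in> B \<and> Suc (fst i) = fst b \<and> \<delta> i \<preceq> \<delta> b"
      using ik kj by (cases i) (auto simp: B_def mdvd_iff_add)
  qed (auto simp: L_def B_def distinct_map inj_on_def)
  have mat: "mat k i j = m k i j" if "i < r k" "j < r (Suc k)" for k i j
  proof -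
    have "lookup (m k i j) c = 0" if "c \<noteq> \<delta> (Suc k, j) - \<delta> (k, i)" for c
      using dz[OF \<open>i < r k\<close> \<open>j < r (Suc k)\<close>] that unfolding degree_zero_map_def
      by (metis add_diff_cancel_left' in_keys_iff)
    then show ?thesis
      using that by (intro poly_mapping_eqI) (auto simp: mat_def L lookup_bd lookup_single when_def)
  qed
  have D: "D k = mat_map (r k) (r (Suc k)) (m k)" for k
    unfolding D_def lenL by (auto simp: mat_map_def fun_eq_iff mat)
  note aug = augmentation[OF r(1), where n = "length (F 0)" and M = "m 0",
      folded D[of 0, unfolded r(2)[of 0]], unfolded m(1)]
  have exact: "{v \<in> free_module (length (L (Suc k))). D k v = (\<lambda>_. 0)}
      = D (Suc k) ` free_module (length (L (Suc (Suc k))))" for k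
    using G by (cases k) (auto simp: graded_free_resolution_def Let_def lenL D r m aug(1)[symmetric])
  then have exact': "{x \<in> strand fst \<delta> B (Suc k) a. lin bd x = 0} = lin bd ` strand fst \<delta> B (Suc (Suc k)) a" for k a
    unfolding exact_iff by blast
  have im: "(\<lambda>v. \<Sum>j<length (F 0). e j * v j) ` free_module (length (F 0)) = ideal.span (monomial ` U)"
    using G by (simp add: graded_free_resolution_def Let_def)
  have L0: "b = (0, 0)" if "b \<in> B" "fst b = 0" for b
    using that r by (cases b) (auto simp: B_def)
  \<comment> \<open>Equal degrees would give the entry a nonzero constant term, but it lies in the
    ideal of the variables.\<close>
  have min2: "\<delta> i \<noteq> \<delta> (Suc (Suc k), j)" if "i \<in> keys (bd (Suc (Suc k), j))" "(Suc (Suc k), j) \<in> B" for i j k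
  proof
    assume eq: "\<delta> i = \<delta> (Suc (Suc k), j)"
    have "0 \<in> keys (d k (snd i) j)" "snd i < r (Suc k)"
      using that unfolding in_keys_iff lookup_bd m eq by (auto split: if_splits)
    moreover have "d k (snd i) j \<in> ideal.span (range var)"
      using dmin[of "snd i" k j] that calculation(2) by (simp add: B_def r)
    ultimately show False
      unfolding mem_ideal_vars_iff by auto
  qed
  \<comment> \<open>A basis element with zero boundary would itself be a boundary, and then occur
    with equal degree in the boundary of another one, against \<open>min2\<close>.\<close>
  have nonzero: "bd (Suc k, j) \<noteq> 0" if "(Suc k, j) \<in> B" for k j
  proof
    assume "bd (Suc k, j) = 0"
    then have "single (Suc k, j) 1 \<in> {x \<in> strand fst \<delta> B (Suc k) (\<delta> (Suc k, j)). lin bd x = 0}"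
      using that by (simp add: strand_def)
    then obtain y where y: "y \<in> strand fst \<delta> B (Suc (Suc k)) (\<delta> (Suc k, j))" "lin bd y = single (Suc k, j) 1"
      unfolding exact' by auto
    then have "(Suc k, j) \<in> keys (lin bd y)" by simp
    from keys_lin[OF this] obtain i where i: "i \<in> keys y" "(Suc k, j) \<in> keys (bd i)"
      by blast
    then have iB: "i \<in> B" "fst i = Suc (Suc k)" "\<delta> i \<preceq> \<delta> (Suc k, j)"
      using strandD[OF y(1)] by auto
    then have "\<delta> i = \<delta> (Suc k, j)"
      using keys_bd[OF iB(1) i(2)] mdvd_antisym by blast
    then show False
      using min2[of "(Suc k, j)" k "snd i"] iB i(2) by (cases i) auto
  qed
  \<comment> \<open>Descent along nonzero boundaries ends in level 1, where the degree is an
    exponent of the entry \<open>e j\<close> of the ideal; the degrees above are multiples of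
    such.\<close>
  have degJ: "\<delta> (Suc k, j) \<in> ?J" if "(Suc k, j) \<in> B" for k j
    using that
  proof (induction k arbitrary: j)
    case 0
    have j: "j < length (F 0)" using 0 by (simp add: B_def r)
    have "e j \<in> ideal.span (monomial ` U)"
      unfolding im[symmetric]
    proof (rule image_eqI)
      show "(\<lambda>i. if i = j then 1 else 0) \<in> free_module (length (F 0))"
        using j by (auto simp: free_module_def)
      show "e j = (\<Sum>i<length (F 0). e i * (if i = j then 1 else 0))"
        using j by (simp add: if_distrib cong: if_cong)
    qed
    moreover obtain i where "i \<in> keys (bd (Suc 0, j))"
      using nonzero[OF 0] by (metis all_not_in_conv keys_eq_empty)
    then have "\<delta> (Suc 0, j) - \<delta> i \<in> keys (e j)" "fst i = 0"
      unfolding in_keys_iff lookup_bd m by (auto split: if_splits)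
    then have "\<delta> (Suc 0, j) \<in> keys (e j)"
      using \<delta>(1) by (cases i) simp
    ultimately show ?case
      unfolding mem_monomial_ideal_iff by blast
  next
    case (Suc k)
    obtain i where "i \<in> keys (bd (Suc (Suc k), j))"
      using nonzero[OF Suc.prems] by (metis all_not_in_conv keys_eq_empty)
    then have "i \<in> B" "fst i = Suc k" "\<delta> i \<preceq> \<delta> (Suc (Suc k), j)"
      using keys_bd[OF Suc.prems] by auto
    then show ?case
      using Suc.IH[of "snd i"] mdvd_trans by (cases i) auto
  qed
  have "lin bd (bd b) = 0" if b: "b \<in> B" for b
  proof (cases "fst b")
    case 0
    then show ?thesis by (cases b) (simp add: bd_def)
  next
    case (Suc k)
    have s: "bd b \<in> strand fst \<delta> B k (\<delta> b)"
      using keys_bd[OF b] Suc by (auto simp: strand_def)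
    show ?thesis
    proof (cases k)
      case 0
      have "bd i = 0" if "i \<in> keys (bd b)" for i
        using strandD[OF s that] 0 by (cases i) (simp add: bd_def)
      then show ?thesis by (rule lin_eq_0)
    next
      case k: (Suc k')
      have "bd b = lin bd (single b 1)" "single b 1 \<in> strand fst \<delta> B (Suc (Suc k')) (\<delta> b)"
        using b Suc k by (auto simp: strand_def)
      then have "bd b \<in> {x \<in> strand fst \<delta> B (Suc k') (\<delta> b). lin bd x = 0}"
        unfolding exact' by blast
      then show ?thesis by blast
    qed
  qed
  then have "based_complex fst \<delta> B bd"
    using keys_bd unfolding based_complex_def by blast
  moreover have "acyclic_on fst \<delta> B bd ?J"
    unfolding acyclic_on_def
  proof (intro ballI allI impI)
    fix a k and v :: "nat \<times> nat \<Rightarrow>\<^sub>0 'k"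
    assume a: "a \<in> ?J" and v: "v \<in> strand fst \<delta> B k a" "lin bd v = 0"
    show "\<exists>y\<in>strand fst \<delta> B (Suc k) a. lin bd y = v"
    proof (cases k)
      case 0
      \<comment> \<open>\<open>exact'\<close> starts at level 1. In level 0 the augmentation is onto
        the ideal, and the part of degree \<open>a\<close> of a preimage of
        \<open>monomial a\<close> bounds the generator \<open>(0, 0)\<close>.\<close>
      have "monomial a \<in> ideal.span (monomial ` U :: ('n, 'k) mpoly set)"
        using a by (simp add: monomial_mem_iff)
      then have "(\<lambda>i. if i = 0 then monomial a else 0) \<in> D 0 ` free_module (length (F 0))"
        unfolding im[symmetric] aug(2) by blast
      then obtain w where w: "D 0 w = (\<lambda>i. if i = 0 then monomial a else 0)"
        by fastforce
      have "lin bd (scl (lookup v (0, 0)) (hcomp 1 a w)) = v"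
      proof (rule strand_eqI[OF _ v(1)[unfolded 0]])
        show "lin bd (scl (lookup v (0, 0)) (hcomp 1 a w)) \<in> strand fst \<delta> B 0 a"
          by (intro bd_strand strand_scl) (simp add: hcomp_strand)
        fix j assume "j < length (L 0)"
        then have j: "j = 0" by (simp add: lenL r)
        have "lookup (hcomp 0 a (D 0 w)) (L 0 ! 0) = 1"
          by (subst lookup_hcomp) (simp_all add: w lenL L r \<delta> monomial_def)
        then show "lookup (lin bd (scl (lookup v (0, 0)) (hcomp 1 a w))) (L 0 ! j) = lookup v (L 0 ! j)"
          unfolding hcomp_D by (simp add: lin_scl j L r)
      qed
      then show ?thesis
        using hcomp_strand 0 by (metis One_nat_def strand_scl)
    next
      case (Suc k')
      then have "v \<in> lin bd ` strand fst \<delta> B (Suc k) a"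
        using v exact' by blast
      then show ?thesis by blast
    qed
  qed
  moreover have "\<delta> b \<in> ?J \<and> fst (0 :: nat, 0 :: nat) < fst b" if "b \<in> B" "b \<noteq> (0, 0)" for b
  proof -
    have "fst b \<noteq> 0" using that L0 by blast
    then obtain k where "b = (Suc k, snd b)"
      by (metis not0_implies_Suc prod.collapse)
    then show ?thesis using degJ that(1) by (metis fst_conv zero_less_Suc)
  qed
  moreover have "\<forall>a\<in>?J. \<forall>b. a \<preceq> b \<longrightarrow> b \<in> ?J"
    using mdvd_trans by blast
  ultimately have "based_resolution fst \<delta> B bd (0, 0) ?J"
    unfolding based_resolution_def by (simp add: B_def r \<delta>)
  moreover have "\<delta> i \<noteq> \<delta> b" if b: "b \<in> B" and i: "i \<in> keys (bd b)" for b i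
  proof -
    have "Suc (fst i) = fst b" "i \<in> B" using keys_bd[OF b i] by auto
    then consider k j where "b = (Suc (Suc k), j)" | j where "b = (Suc 0, j)" "i = (0, 0)"
      using L0 by (cases b; cases "fst i") auto
    then show ?thesis
    proof cases
      case 1
      then show ?thesis using min2 b i by simp
    next
      case 2
      \<comment> \<open>Minimality speaks of the matrices \<open>d\<close> only. For the
        augmentation, \<open>0 \<notin> U\<close> keeps the degrees of level 1 away from the degree
        0 of the ring.\<close>
      have "\<not> u \<preceq> 0" if "u \<in> U" for u
        using \<open>0 \<notin> U\<close> that mdvd_antisym zero_mdvd by metis
      then show ?thesis using 2 degJ b \<delta> by force
    qed
  qed
  ultimately show ?thesis
    unfolding B_def by blast
qed

text \<open>The cone and the chosen resolution are both minimal, so every degree of either one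
  occurs in the other at the same level.\<close>

lemma betti_nonzero_iff:
  fixes \<delta> :: "'b \<Rightarrow> 'n expo" and bd :: "'b \<Rightarrow> 'b \<Rightarrow>\<^sub>0 'k::field"
  assumes R: "based_resolution h \<delta> B bd z {a. \<exists>u\<in>U. u \<preceq> a}" and z: "h z = 0" "\<delta> z = 0"
    and fin: "\<And>k. finite {j \<in> B. h j = k}"
    and min: "\<And>j i. j \<in> B \<Longrightarrow> i \<in> keys (bd j) \<Longrightarrow> \<delta> i \<noteq> \<delta> j"
    and "0 \<notin> U"
  shows "betti (ideal.span (monomial ` U) :: ('n, 'k) mpoly set) k a \<noteq> 0 \<longleftrightarrow> (\<exists>j\<in>B. h j = Suc k \<and> \<delta> j = a)"
proof -
  let ?I = "ideal.span (monomial ` U) :: ('n, 'k) mpoly set"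
  define F where "F = (SOME F. \<exists>d e. minimal_graded_free_resolution ?I F d e)"
  have "\<exists>d e. minimal_graded_free_resolution ?I F d e"
    unfolding F_def by (rule someI_ex[of "\<lambda>F. \<exists>d e. minimal_graded_free_resolution ?I F d e"])
      (rule minimal_resolution_exists[OF R z fin min])
  then obtain d e where M: "minimal_graded_free_resolution ?I F d e" by blast
  define r where "r = case_nat 1 (\<lambda>k. length (F k))"
  define \<delta>' where "\<delta>' = (\<lambda>(k, j). case k of 0 \<Rightarrow> 0 | Suc k \<Rightarrow> F k ! j)"
  obtain bd' :: "nat \<times> nat \<Rightarrow> nat \<times> nat \<Rightarrow>\<^sub>0 'k" where
    R': "based_resolution fst \<delta>' {(k, j). j < r k} bd' (0, 0) {a. \<exists>u\<in>U. u \<preceq> a}" and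
    min': "\<And>j i. j \<in> {(k, j). j < r k} \<Longrightarrow> i \<in> keys (bd' j) \<Longrightarrow> \<delta>' i \<noteq> \<delta>' j"
    using based_resolution_of_minimal_resolution[OF M \<open>0 \<notin> U\<close>] unfolding r_def \<delta>'_def by blast
  have z': "fst (0 :: nat, 0 :: nat) = 0" "\<delta>' (0, 0) = 0"
    by (simp_all add: \<delta>'_def)
  have "betti ?I k a \<noteq> 0 \<longleftrightarrow> a \<in> set (F k)"
    by (simp add: betti_def F_def[symmetric] count_list_0_iff)
  also have "\<dots> \<longleftrightarrow> (\<exists>i\<in>{(k, j). j < r k}. fst i = Suc k \<and> \<delta>' i = a)"
    by (auto simp: in_set_conv_nth r_def \<delta>'_def)
  also have "\<dots> \<longleftrightarrow> (\<exists>j\<in>B. h j = Suc k \<and> \<delta> j = a)"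
    using minimal_resolution_degrees[OF R' R z'(1) z(1) _ min']
      minimal_resolution_degrees[OF R R' z(1) z'(1) _ min] z z' by metis
  finally show ?thesis .
qed

section \<open>Radicals of monomial ideals\<close>

text \<open>A multiplicative map on exponents extends to a ring homomorphism; it serves to
  substitute 0 for variables.\<close>

lemma lin_mult:
  fixes \<phi> :: "'a::comm_monoid_add \<Rightarrow> 'c::comm_monoid_add \<Rightarrow>\<^sub>0 'k::field"
  assumes "\<And>a b. \<phi> (a + b) = \<phi> a * \<phi> b"
  shows "lin \<phi> (f * g) = lin \<phi> f * lin \<phi> g"
proof -
  have s: "scl c x = single 0 c * x" for c and x :: "'c \<Rightarrow>\<^sub>0 'k"
    by (simp add: scl_def mult_map_scale_conv_mult)
  have "f * g = (\<Sum>a\<in>keys f. single a (lookup f a)) * (\<Sum>b\<in>keys g. single b (lookup g b))"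
    using poly_sum_single[of f] poly_sum_single[of g] by simp
  also have "\<dots> = (\<Sum>a\<in>keys f. \<Sum>b\<in>keys g. single (a + b) (lookup f a * lookup g b))"
    by (simp add: sum_product single_mult)
  finally have "lin \<phi> (f * g) = (\<Sum>a\<in>keys f. \<Sum>b\<in>keys g. scl (lookup f a * lookup g b) (\<phi> a * \<phi> b))"
    by (simp add: lin_sum assms)
  also have "\<dots> = (\<Sum>a\<in>keys f. \<Sum>b\<in>keys g. scl (lookup f a) (\<phi> a) * scl (lookup g b) (\<phi> b))"
  proof (intro sum.cong refl)
    fix a b
    have "single 0 (c * d) = single 0 c * (single 0 d :: 'c \<Rightarrow>\<^sub>0 'k)" for c d
      by (simp add: single_mult)
    then show "scl (lookup f a * lookup g b) (\<phi> a * \<phi> b) = scl (lookup f a) (\<phi> a) * scl (lookup g b) (\<phi> b)"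
      by (simp only: s mult_ac)
  qed
  finally show ?thesis
    by (simp add: lin_def sum_product)
qed

lemma lin_power:
  fixes \<phi> :: "'a::comm_monoid_add \<Rightarrow> 'c::comm_monoid_add \<Rightarrow>\<^sub>0 'k::field"
  assumes "\<And>a b. \<phi> (a + b) = \<phi> a * \<phi> b" and "\<phi> 0 = 1"
  shows "lin \<phi> (f ^ n) = lin \<phi> f ^ n"
proof (induction n)
  case 0
  have "lin \<phi> 1 = \<phi> 0" by (simp add: lin_def)
  then show ?case using assms(2) by simp
qed (simp add: lin_mult[of \<phi>, OF assms(1)])

lemma monomial_mult: "monomial a * monomial b = monomial (a + b)"
  by (simp add: monomial_def single_mult)

lemma monomial_power: "monomial a ^ n = monomial (\<Sum>i<n. a)"
proof (induction n)
  case 0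
  show ?case by (simp add: monomial_def)
next
  case (Suc n)
  then show ?case by (simp add: monomial_mult add.commute)
qed

lemma subspace_radical: "ideal.subspace (radical (ideal.span S))"
proof -
  let ?I = "ideal.span S"
  have "f + g \<in> radical ?I" if "f ^ m \<in> ?I" "m \<ge> 1" "g ^ n \<in> ?I" for f g :: 'a and m n
  proof -
    have "of_nat (m + n choose k) * f ^ k * g ^ (m + n - k) \<in> ?I" if "k \<le> m + n" for k
    proof (cases "k \<ge> m")
      case True
      then have "f ^ k = f ^ (k - m) * f ^ m"
        by (simp flip: power_add)
      then have "f ^ k \<in> ?I"
        using \<open>f ^ m \<in> ?I\<close> ideal.span_scale by metis
      then have "(of_nat (m + n choose k) * g ^ (m + n - k)) * f ^ k \<in> ?I"
        by (rule ideal.span_scale)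
      then show ?thesis by (simp only: mult_ac)
    next
      case False
      then have "g ^ (m + n - k) = g ^ (m - k) * g ^ n"
        by (simp flip: power_add)
      then have "g ^ (m + n - k) \<in> ?I"
        using \<open>g ^ n \<in> ?I\<close> ideal.span_scale by metis
      then show ?thesis by (rule ideal.span_scale)
    qed
    then have "(f + g) ^ (m + n) \<in> ?I"
      unfolding binomial_ring by (intro ideal.span_sum) auto
    then show ?thesis
      using \<open>m \<ge> 1\<close> unfolding radical_def by (intro CollectI exI[of _ "m + n"]) simp
  qed
  moreover have "(c * f) ^ m \<in> ?I" if "f ^ m \<in> ?I" for c f m
    unfolding power_mult_distrib using that by (rule ideal.span_scale)
  moreover have "0 \<in> radical ?I"
    using ideal.span_zero by (auto simp: radical_def intro!: exI[of _ 1])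
  ultimately show ?thesis
    unfolding ideal.subspace_def by (auto simp: radical_def)
qed

text \<open>
  If the monomial \<open>x\<^sup>a\<close> of \<open>f\<close> violates the claim, then setting the variables that do not divide
  \<open>x\<^sup>a\<close> to zero kills the ideal but not \<open>f\<close>, and the quotient is a domain. The exponents are
  embedded into \<open>nat \<Rightarrow>\<^sub>0 nat\<close> because the library only knows polynomial rings to be domains when
  the monomials are linearly ordered.
\<close>

lemma radical_monomial_ideal:
  fixes A :: "'n::finite expo set"
  shows "radical (ideal.span (monomial ` A)) =
    (ideal.span (monomial ` (\<lambda>a. sqfree (keys a)) ` A) :: ('n, 'k::field) mpoly set)"
proof
  have "monomial (sqfree (keys a)) \<in> radical (ideal.span (monomial ` A) :: ('n, 'k) mpoly set)"
    if "a \<in> A" for a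
  proof -
    \<comment> \<open>The sum bounds every single exponent; \<open>Suc\<close> makes
      \<open>N\<close> positive, as \<open>radical\<close> demands.\<close>
    define N where "N = Suc (\<Sum>i\<in>UNIV. lookup a i)"
    have "lookup a i \<le> N" for i
      unfolding N_def by (rule le_SucI) (simp add: member_le_sum)
    then have "a \<preceq> (\<Sum>i<N. sqfree (keys a))"
      by (auto simp: mdvd_def lookup_sum lookup_sqfree in_keys_iff)
    then have "monomial (sqfree (keys a)) ^ N \<in> ideal.span (monomial ` A :: ('n, 'k) mpoly set)"
      unfolding monomial_power monomial_mem_iff using that by blast
    then show ?thesis
      unfolding radical_def by (intro CollectI exI[of _ N]) (simp add: N_def)
  qed
  then show "ideal.span (monomial ` (\<lambda>a. sqfree (keys a)) ` A)
      \<subseteq> radical (ideal.span (monomial ` A) :: ('n, 'k) mpoly set)"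
    by (intro ideal.span_minimal subspace_radical) auto
next
  show "radical (ideal.span (monomial ` A))
      \<subseteq> (ideal.span (monomial ` (\<lambda>a. sqfree (keys a)) ` A) :: ('n, 'k) mpoly set)"
  proof
    fix f :: "('n, 'k) mpoly"
    assume "f \<in> radical (ideal.span (monomial ` A))"
    then obtain n where n: "f ^ n \<in> ideal.span (monomial ` A)"
      by (auto simp: radical_def)
    show "f \<in> ideal.span (monomial ` (\<lambda>a. sqfree (keys a)) ` A)"
      unfolding mem_monomial_ideal_iff
    proof (rule ballI, rule ccontr)
      fix a assume a: "a \<in> keys f" "\<not> (\<exists>u\<in>(\<lambda>a. sqfree (keys a)) ` A. u \<preceq> a)"
      obtain \<rho> :: "'n \<Rightarrow> nat" where \<rho>: "inj \<rho>"
        using finite_imp_inj_to_nat_seg[OF finite[of "UNIV :: 'n set"]] by blast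
      define \<kappa> :: "'n expo \<Rightarrow> nat \<Rightarrow>\<^sub>0 nat" where "\<kappa> b = (\<Sum>i\<in>UNIV. single (\<rho> i) (lookup b i))" for b
      have "lookup (\<kappa> b) (\<rho> i) = lookup b i" for b i
        using inj_eq[OF \<rho>] by (simp add: \<kappa>_def lookup_sum lookup_single when_def)
      then have \<kappa>_inj: "b = c" if "\<kappa> b = \<kappa> c" for b c
        using that by (intro poly_mapping_eqI) metis
      define \<phi> :: "'n expo \<Rightarrow> (nat \<Rightarrow>\<^sub>0 nat) \<Rightarrow>\<^sub>0 'k" where
        "\<phi> b = (if keys b \<subseteq> keys a then single (\<kappa> b) 1 else 0)" for b
      have "keys (b + c) = keys b \<union> keys c" for b c :: "'n expo"
        by (auto simp: in_keys_iff lookup_add)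
      then have "\<phi> (b + c) = \<phi> b * \<phi> c" for b c
        by (simp add: \<phi>_def single_mult \<kappa>_def lookup_add single_add sum.distrib)
      moreover have "\<phi> 0 = 1"
        by (simp add: \<phi>_def \<kappa>_def)
      ultimately have "lin \<phi> f ^ n = lin \<phi> (f ^ n)"
        by (rule lin_power[symmetric])
      also have "\<dots> = 0"
      proof (rule lin_eq_0)
        fix b assume "b \<in> keys (f ^ n)"
        then obtain c where c: "c \<in> A" "c \<preceq> b"
          using n unfolding mem_monomial_ideal_iff by blast
        then have "\<not> keys c \<subseteq> keys a"
          using a(2) by (auto simp: sqfree_mdvd_iff)
        moreover have "keys c \<subseteq> keys b"
          using c(2) unfolding mdvd_def by (metis in_keys_iff le_zero_eq subsetI)
        ultimately show "\<phi> b = 0" by (auto simp: \<phi>_def)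
      qed
      finally have "lin \<phi> f = 0" by simp
      moreover have "lookup (lin \<phi> f) (\<kappa> a) = (\<Sum>b\<in>keys f. if b = a then lookup f b else 0)"
        unfolding lookup_lin by (rule sum.cong) (auto simp: \<phi>_def lookup_single when_def dest: \<kappa>_inj)
      ultimately show False
        using a(1) by (simp add: in_keys_iff)
    qed
  qed
qed

section \<open>Homological shifts of ideals with linear quotients\<close>

text \<open>Serves both sides of the theorem with \<open>c = 1\<close> and the same sets
  \<open>S\<close>: once for the generators of the weighted ideal, once for their radicals.\<close>

lemma HS_linear_quotients:
  fixes u :: "nat \<Rightarrow> 'n::finite expo"
  assumes lq: "linear_quotient_sets m u S"
    and card: "\<And>p. p < m \<Longrightarrow> card (keys (u p)) = Suc c" and disj: "\<And>p. p < m \<Longrightarrow> S p \<inter> keys (u p) = {}"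
  shows "HS k (ideal.span (monomial ` u ` {..<m}) :: ('n, 'k::field) mpoly set) =
    ideal.span (monomial ` {u p + sqfree F | p F. p < m \<and> F \<subseteq> S p \<and> card F = k})"
proof -
  have J: "{a. \<exists>p<m. u p \<preceq> a} = {a. \<exists>v\<in>u ` {..<m}. v \<preceq> a}"
    by auto
  obtain bd :: "nat \<times> 'n set \<Rightarrow> nat \<times> 'n set \<Rightarrow>\<^sub>0 'k" where
    R: "based_resolution lq_level (lq_degree u) (lq_basis m S) bd (0, {}) {a. \<exists>v\<in>u ` {..<m}. v \<preceq> a}"
    using linear_quotients_resolution[OF lq] unfolding J by blast
  have "lq_basis m S \<subseteq> {..m} \<times> UNIV"
    by (auto simp: lq_basis_def)
  then have "finite (lq_basis m S)"
    by (rule finite_subset) simp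
  then have fin: "finite {j \<in> lq_basis m S. lq_level j = k}" for k
    by simp
  have "0 \<notin> u ` {..<m}"
    using card by force
  then have "betti (ideal.span (monomial ` u ` {..<m}) :: ('n, 'k) mpoly set) k a \<noteq> 0 \<longleftrightarrow>
      (\<exists>j\<in>lq_basis m S. lq_level j = Suc k \<and> lq_degree u j = a)" for a
    using linear_quotients_minimal[OF based_resolutionD(1)[OF R] card disj]
    by (intro betti_nonzero_iff[OF R _ _ fin]) (auto simp: lq_level_def lq_degree_def)
  also have "(\<exists>j\<in>lq_basis m S. lq_level j = Suc k \<and> lq_degree u j = a) \<longleftrightarrow>
      a \<in> {u p + sqfree F | p F. p < m \<and> F \<subseteq> S p \<and> card F = k}" for a
  proof
    assume "\<exists>j\<in>lq_basis m S. lq_level j = Suc k \<and> lq_degree u j = a"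
    then obtain p F where "p < m" "F \<subseteq> S p" "lq_level (Suc p, F) = Suc k" "lq_degree u (Suc p, F) = a"
      by (auto simp: lq_basis_def lq_level_def)
    then show "a \<in> {u p + sqfree F | p F. p < m \<and> F \<subseteq> S p \<and> card F = k}"
      unfolding lq_level_def lq_degree_def by auto
  next
    assume "a \<in> {u p + sqfree F | p F. p < m \<and> F \<subseteq> S p \<and> card F = k}"
    then obtain p F where "a = u p + sqfree F" "p < m" "F \<subseteq> S p" "card F = k"
      by blast
    then show "\<exists>j\<in>lq_basis m S. lq_level j = Suc k \<and> lq_degree u j = a"
      by (intro bexI[of _ "(Suc p, F)"]) (auto simp: lq_basis_def lq_level_def lq_degree_def)
  qed
  finally show ?thesis
    unfolding HS_def by (simp add: setcompr_eq_image)
qed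

text \<open>If \<open>s\<close> divided \<open>u p\<close>, the earlier generator dividing
  \<open>u p\<close> times the variable \<open>s\<close> would have its support inside that of
  \<open>u p\<close>, hence equal to it by size.\<close>

lemma linear_quotient_sets_disjoint:
  assumes lq: "linear_quotient_sets m u S" and card: "\<And>p. p < m \<Longrightarrow> card (keys (u p)) = c"
    and inj: "\<And>p q. p < m \<Longrightarrow> q < m \<Longrightarrow> keys (u p) = keys (u q) \<Longrightarrow> p = q"
    and p: "p < m" "s \<in> S p"
  shows "s \<notin> keys (u p) \<and> (\<exists>q<p. keys (u q) \<subseteq> insert s (keys (u p)))"
proof -
  have "S p \<inter> keys (single s (1 :: nat)) \<noteq> {}" using p by simp
  then obtain q where q: "q < p" "u q \<preceq> u p + single s 1"
    using lq p unfolding linear_quotient_sets_def by metis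
  have "keys (u q) \<subseteq> keys (u p + single s 1)"
    using q(2) unfolding mdvd_def by (metis in_keys_iff le_zero_eq subsetI)
  also have "\<dots> \<subseteq> insert s (keys (u p))"
    using keys_add[of "u p" "single s 1"] by simp
  finally have sub: "keys (u q) \<subseteq> insert s (keys (u p))" .
  have "s \<notin> keys (u p)"
  proof
    assume "s \<in> keys (u p)"
    then have "keys (u q) \<subseteq> keys (u p)" using sub by blast
    then have "keys (u q) = keys (u p)"
      using card p(1) q(1) by (intro card_subset_eq) auto
    then show False using inj[of q p] p(1) q(1) by auto
  qed
  then show ?thesis using sub q(1) by blast
qed

lemma linear_quotient_sets_sqfree:
  fixes u :: "nat \<Rightarrow> 'n::finite expo"
  assumes lq: "linear_quotient_sets m u S" and card: "\<And>p. p < m \<Longrightarrow> card (keys (u p)) = c"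
    and inj: "\<And>p q. p < m \<Longrightarrow> q < m \<Longrightarrow> keys (u p) = keys (u q) \<Longrightarrow> p = q"
  shows "linear_quotient_sets m (\<lambda>p. sqfree (keys (u p))) S"
  unfolding linear_quotient_sets_def
proof (intro allI impI iffI)
  fix p and a :: "'n expo"
  assume p: "p < m"
  have keys: "sqfree F \<preceq> sqfree G + a \<longleftrightarrow> F \<subseteq> G \<union> keys a" for F G
    by (auto simp: sqfree_mdvd_iff in_keys_iff lookup_add lookup_sqfree split: if_splits)
  {
    assume "\<exists>q<p. sqfree (keys (u q)) \<preceq> sqfree (keys (u p)) + a"
    then obtain q where q: "q < p" "keys (u q) \<subseteq> keys (u p) \<union> keys a"
      unfolding keys by blast
    \<comment> \<open>The truncated difference is \<open>u q\<close> divided by its greatest common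
      divisor with \<open>u p\<close>, an element of the colon ideal. A variable of
      \<open>S p\<close> dividing it lies in the support of \<open>u q\<close> but not of
      \<open>u p\<close>, hence in that of \<open>a\<close>.\<close>
    have "u q \<preceq> u p + (u q - u p)"
      unfolding mdvd_def lookup_add lookup_minus by (intro allI) linarith
    then obtain s where s: "s \<in> S p" "s \<in> keys (u q - u p)"
      using lq p q(1) unfolding linear_quotient_sets_def by blast
    then have "s \<in> keys (u q)" by (simp add: in_keys_iff lookup_minus)
    moreover have "s \<notin> keys (u p)"
      using linear_quotient_sets_disjoint[OF lq card inj p s(1)] by blast
    ultimately show "S p \<inter> keys a \<noteq> {}"
      using q(2) s(1) by blast
  next
    assume "S p \<inter> keys a \<noteq> {}"
    then obtain s where s: "s \<in> S p" "s \<in> keys a" by blast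
    then obtain q where "q < p" "keys (u q) \<subseteq> insert s (keys (u p))"
      using linear_quotient_sets_disjoint[OF lq card inj p s(1)] by blast
    then show "\<exists>q<p. sqfree (keys (u q)) \<preceq> sqfree (keys (u p)) + a"
      unfolding keys using s(2) by blast
  }
qed

text \<open>Irredundance makes \<open>U\<close> an antichain for divisibility, and an antichain
  consists of the minimal elements of its upward closure, which the ideal determines.\<close>

lemma minimal_monomial_generators_unique:
  assumes U: "minimal_monomial_generators U (ideal.span (monomial ` U') :: ('n, 'k::field) mpoly set)"
    and anti: "\<And>a b. a \<in> U' \<Longrightarrow> b \<in> U' \<Longrightarrow> a \<preceq> b \<Longrightarrow> a = b"
  shows "U = U'"
proof -
  have eq: "ideal.span (monomial ` U) = (ideal.span (monomial ` U') :: ('n, 'k) mpoly set)"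
    and min: "\<And>T. T \<subset> U \<Longrightarrow> ideal.span (monomial ` T) \<noteq> (ideal.span (monomial ` U') :: ('n, 'k) mpoly set)"
    using U by (auto simp: minimal_monomial_generators_def)
  have up: "(\<exists>u\<in>U. u \<preceq> a) \<longleftrightarrow> (\<exists>u\<in>U'. u \<preceq> a)" for a
    using eq monomial_mem_iff[where 'k = 'k, of a U] monomial_mem_iff[where 'k = 'k, of a U'] by simp
  have antiU: "a = b" if "a \<in> U" "b \<in> U" "a \<preceq> b" for a b
  proof (rule ccontr)
    assume "a \<noteq> b"
    then have "(\<exists>u\<in>U - {b}. u \<preceq> c) \<longleftrightarrow> (\<exists>u\<in>U. u \<preceq> c)" for c
      using that mdvd_trans by (metis Diff_iff singletonD)
    then have "ideal.span (monomial ` (U - {b})) = (ideal.span (monomial ` U) :: ('n, 'k) mpoly set)"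
      by (simp add: set_eq_iff mem_monomial_ideal_iff)
    moreover have "U - {b} \<subset> U" using that(2) by blast
    ultimately show False using min eq by blast
  qed
  show ?thesis
  proof (intro set_eqI iffI)
    fix a assume a: "a \<in> U"
    then obtain b where b: "b \<in> U'" "b \<preceq> a" using up mdvd_refl by blast
    then obtain c where "c \<in> U" "c \<preceq> b" using up mdvd_refl by blast
    then show "a \<in> U'"
      using a b antiU mdvd_trans mdvd_antisym by metis
  next
    fix a assume a: "a \<in> U'"
    then obtain b where b: "b \<in> U" "b \<preceq> a" using up mdvd_refl by blast
    then obtain c where "c \<in> U'" "c \<preceq> b" using up mdvd_refl by blast
    then show "a \<in> U"
      using a b anti mdvd_trans mdvd_antisym by metis
  qed
qed

lemma linear_quotient_sets_exist:
  assumes "\<And>i. 1 \<le> i \<Longrightarrow> i < length us \<Longrightarrow>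
    \<exists>V. colon (ideal.span (monomial ` set (take i us))) (monomial (us ! i))
      = (ideal.span (var ` V) :: ('n, 'k::field) mpoly set)"
  shows "\<exists>S. linear_quotient_sets (length us) ((!) us) S"
proof -
  have "\<exists>V. \<forall>a. (\<exists>q<p. us ! q \<preceq> us ! p + a) \<longleftrightarrow> V \<inter> keys a \<noteq> {}" if p: "p < length us" for p
  proof (cases "p = 0")
    case False
    then obtain V where V: "colon (ideal.span (monomial ` set (take p us))) (monomial (us ! p))
        = (ideal.span (var ` V) :: ('n, 'k) mpoly set)"
      using assms[of p] p by auto
    have "set (take p us) = (!) us ` {..<p}"
      using nth_image[of p us] p by (simp add: lessThan_atLeast0)
    then have "(\<exists>q<p. us ! q \<preceq> us ! p + a) \<longleftrightarrow> (monomial a :: ('n, 'k) mpoly)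
        \<in> colon (ideal.span (monomial ` set (take p us))) (monomial (us ! p))" for a
      by (auto simp: colon_def monomial_mult monomial_mem_iff add.commute)
    also have "\<dots> a \<longleftrightarrow> V \<inter> keys a \<noteq> {}" for a
      unfolding V mem_ideal_vars_iff by (simp add: monomial_def)
    finally show ?thesis by blast
  \<comment> \<open>At \<open>p = 0\<close> there are no earlier generators, so the empty set of
    variables is right.\<close>
  qed (auto intro: exI[of _ "{}"])
  then show ?thesis
    unfolding linear_quotient_sets_def by metis
qed

section \<open>Edge ideals\<close>

definition edge_expo :: "('n \<Rightarrow> nat) \<Rightarrow> 'n \<times> 'n \<Rightarrow> 'n expo" where
  "edge_expo w = (\<lambda>(i, j). single i 1 + single j (w j))"

lemma keys_edge_expo: "w j \<ge> 1 \<Longrightarrow> keys (edge_expo w (i, j)) = {i, j}"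
  by (auto simp: edge_expo_def in_keys_iff lookup_add lookup_single when_def split: if_splits)

lemma var_power: "var j ^ n = (monomial (single j n) :: ('n, 'k::field) mpoly)"
proof (induction n)
  case (Suc n)
  then show ?case
    by (simp add: var_def monomial_mult flip: single_add)
qed (simp add: monomial_def)

lemma weighted_edge_ideal_eq:
  "weighted_edge_ideal E w = (ideal.span (monomial ` edge_expo w ` E) :: ('n, 'k::field) mpoly set)"
proof -
  have "{var i * var j ^ w j | i j. (i, j) \<in> E} = (monomial ` edge_expo w ` E :: ('n, 'k) mpoly set)"
    unfolding var_power by (force simp: var_def monomial_mult edge_expo_def)
  then show ?thesis by (simp add: weighted_edge_ideal_def)
qed

text \<open>Asymmetry excludes loops, so every product is squarefree, and the two ways of writing an
  edge give the same monomial.\<close>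

lemma edge_ideal_eq:
  fixes E :: "('n::finite \<times> 'n) set"
  assumes "asym E"
  shows "edge_ideal (underlying_graph E)
    = (ideal.span (monomial ` (\<lambda>(i, j). sqfree {i, j}) ` E) :: ('n, 'k::field) mpoly set)"
proof -
  have m: "var i * var j = (monomial (sqfree {i, j}) :: ('n, 'k) mpoly)" if "i \<noteq> j" for i j
    using that by (simp add: var_def monomial_mult sqfree_def)
  have G: "{i, j} \<in> underlying_graph E \<longleftrightarrow> (i, j) \<in> E \<or> (j, i) \<in> E" for i j
    by (auto simp: underlying_graph_def doubleton_eq_iff)
  have ne: "i \<noteq> j" if "(i, j) \<in> E" for i j
    using that assms by (auto dest: asymD)
  have "{var i * var j | i j. {i, j} \<in> underlying_graph E}
      = (monomial ` (\<lambda>(i, j). sqfree {i, j}) ` E :: ('n, 'k) mpoly set)"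
  proof (intro set_eqI iffI)
    fix x :: "('n, 'k) mpoly"
    assume "x \<in> {var i * var j | i j. {i, j} \<in> underlying_graph E}"
    then obtain i j where x: "x = var i * var j" and "(i, j) \<in> E \<or> (j, i) \<in> E"
      unfolding G by blast
    then obtain i' j' where "(i', j') \<in> E" "x = monomial (sqfree {i', j'})"
      using m ne by (metis insert_commute)
    then show "x \<in> monomial ` (\<lambda>(i, j). sqfree {i, j}) ` E"
      by force
  next
    fix x :: "('n, 'k) mpoly"
    assume "x \<in> monomial ` (\<lambda>(i, j). sqfree {i, j}) ` E"
    then obtain i j where "(i, j) \<in> E" "x = monomial (sqfree {i, j})"
      by auto
    then show "x \<in> {var i * var j | i j. {i, j} \<in> underlying_graph E}"
      unfolding G using m[OF ne] by (intro CollectI exI[of _ i] exI[of _ j]) simp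
  qed
  then show ?thesis by (simp add: edge_ideal_def)
qed

theorem theorem4p6:
  fixes E :: "('n::finite \<times> 'n) set" and w :: "'n \<Rightarrow> nat"
  assumes "weighted_oriented_graph E w"
    and "has_linear_quotients (weighted_edge_ideal E w :: ('n, 'k::field) mpoly set)"
  shows "\<forall>k. radical (HS k (weighted_edge_ideal E w :: ('n, 'k) mpoly set))
             = HS k (edge_ideal (underlying_graph E))"
proof
  fix k
  have asym: "asym E" and w: "\<And>i. w i \<ge> 1"
    using assms(1) by (auto simp: weighted_oriented_graph_def)
  have keysE: "keys (edge_expo w e) = {fst e, snd e}" for e
    using keys_edge_expo[of w "snd e" "fst e"] w by simp
  \<comment> \<open>The reverse of an edge is not an edge, so the vertex set determines the
    orientation.\<close>
  have eqE: "e = e'" if "e \<in> E" "e' \<in> E" "{fst e, snd e} = {fst e', snd e'}" for e e'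
    using that asymD[OF asym] by (cases e; cases e') (auto simp: doubleton_eq_iff)
  have card2: "card {fst e, snd e} = 2" if "e \<in> E" for e
    using that asymD[OF asym] by (cases e) (auto simp: card_insert_if)
  have anti: "a = b" if ab: "a \<in> edge_expo w ` E" "b \<in> edge_expo w ` E" "a \<preceq> b" for a b
  proof -
    obtain e e' where e: "e \<in> E" "e' \<in> E" "a = edge_expo w e" "b = edge_expo w e'"
      using ab by blast
    have "keys a \<subseteq> keys b"
      using ab(3) unfolding mdvd_def by (metis in_keys_iff le_zero_eq subsetI)
    then have "keys a = keys b"
      using e card2 by (intro card_subset_eq) (auto simp: keysE)
    then show ?thesis using e eqE[OF e(1,2)] by (simp add: keysE)
  qed
  obtain us where us: "distinct us"
    "minimal_monomial_generators (set us) (weighted_edge_ideal E w :: ('n, 'k) mpoly set)"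
    and col: "\<And>i. 1 \<le> i \<Longrightarrow> i < length us \<Longrightarrow>
      \<exists>V. colon (ideal.span (monomial ` set (take i us))) (monomial (us ! i))
        = (ideal.span (var ` V) :: ('n, 'k) mpoly set)"
    using assms(2) unfolding has_linear_quotients_def by blast
  have set_us: "set us = edge_expo w ` E"
    using us(2) anti unfolding weighted_edge_ideal_eq by (rule minimal_monomial_generators_unique)
  obtain S where lq: "linear_quotient_sets (length us) ((!) us) S"
    using linear_quotient_sets_exist[OF col] by blast
  let ?m = "length us"
  have usE: "\<exists>e\<in>E. us ! p = edge_expo w e" if "p < ?m" for p
    using that set_us nth_mem by blast
  have card: "card (keys (us ! p)) = Suc 1" if "p < ?m" for p
    using usE[OF that] card2 by (auto simp: keysE)
  have inj: "p = q" if pq: "p < ?m" "q < ?m" "keys (us ! p) = keys (us ! q)" for p q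
  proof -
    obtain e e' where e: "e \<in> E" "us ! p = edge_expo w e" "e' \<in> E" "us ! q = edge_expo w e'"
      using usE[OF pq(1)] usE[OF pq(2)] by blast
    then have "us ! p = us ! q"
      using pq(3) eqE[OF e(1,3)] by (simp add: keysE)
    then show ?thesis using us(1) pq(1,2) nth_eq_iff_index_eq by blast
  qed
  have disj: "S p \<inter> keys (us ! p) = {}" if "p < ?m" for p
    using linear_quotient_sets_disjoint[OF lq card inj that] by blast
  have image_us: "(!) us ` {..<?m} = set us"
    using nth_image[of ?m us] by (simp add: lessThan_atLeast0)
  \<comment> \<open>\<open>F\<close> avoids the support of the generator, so taking radicals only
    affects the factor \<open>us ! p\<close>.\<close>
  have sq: "sqfree (keys (us ! p + sqfree F)) = sqfree (keys (us ! p)) + sqfree F"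
    if "p < ?m" "F \<subseteq> S p" for p F
    using disj[OF that(1)] that(2)
    by (intro poly_mapping_eqI) (auto simp: lookup_sqfree lookup_add in_keys_iff)
  have "(\<lambda>a. sqfree (keys a)) ` {us ! p + sqfree F | p F. p < ?m \<and> F \<subseteq> S p \<and> card F = k}
      = {sqfree (keys (us ! p + sqfree F)) | p F. p < ?m \<and> F \<subseteq> S p \<and> card F = k}"
    by blast
  also have "\<dots> = {sqfree (keys (us ! p)) + sqfree F | p F. p < ?m \<and> F \<subseteq> S p \<and> card F = k}"
    by (rule Collect_cong) (metis sq)
  finally have "radical (HS k (weighted_edge_ideal E w :: ('n, 'k) mpoly set))
      = ideal.span (monomial ` {sqfree (keys (us ! p)) + sqfree F | p F. p < ?m \<and> F \<subseteq> S p \<and> card F = k})"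
    using HS_linear_quotients[OF lq card disj, where 'k = 'k and k = k]
    by (simp add: weighted_edge_ideal_eq set_us[symmetric] image_us radical_monomial_ideal)
  also have "\<dots> = HS k (ideal.span (monomial ` (\<lambda>p. sqfree (keys (us ! p))) ` {..<?m}))"
  proof (rule HS_linear_quotients[symmetric])
    show "linear_quotient_sets ?m (\<lambda>p. sqfree (keys (us ! p))) S"
      by (rule linear_quotient_sets_sqfree[OF lq card inj])
    show "card (keys (sqfree (keys (us ! p)))) = Suc 1" if "p < ?m" for p
      using card[OF that] by simp
    show "S p \<inter> keys (sqfree (keys (us ! p))) = {}" if "p < ?m" for p
      using disj[OF that] by simp
  qed
  also have "(\<lambda>p. sqfree (keys (us ! p))) ` {..<?m} = (\<lambda>(i, j). sqfree {i, j}) ` E"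
    unfolding image_image[of "\<lambda>a. sqfree (keys a)" "(!) us", symmetric] image_us set_us
    by (simp add: image_image keysE case_prod_beta)
  finally show "radical (HS k (weighted_edge_ideal E w :: ('n, 'k) mpoly set))
      = HS k (edge_ideal (underlying_graph E))"
    unfolding edge_ideal_eq[OF asym] .
qed

end
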